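(* Let $\lambda,\nu$ be $\sigma$-finite measures on a measurable space $(\mathbb X,\mathcal X)$. Assume that $$\mathbb E_\nu f(\Phi)=\mathbb E_\lambda f(\Phi)+\sum_{n=1}^\infty\frac1{n!}\int\big(\mathbb E_\lambda D^n_{x_1,\ldots,x_n}f(\Phi)\big)\,(\nu-\lambda)^n(\mathrm d(x_1,\ldots,x_n))$$ holds for all bounded measurable $f:\mathbf N\to\mathbb R$. Then $\Pi_\lambda$ and $\Pi_\nu$ are not (mutually) singular and $H(\lambda,\nu)<\infty$.
   Context: $\mathbf N$ is the space of $\sigma$-finite measures $\varphi$ on $\mathbb X$ with values in $\{0,1,2,\ldots\}\cup\{\infty\}$, equipped with the smallest $\sigma$-field making all maps $\varphi\mapsto\varphi(B)$, $B\in\mathcal X$, measurable. For a $\sigma$-finite measure $\lambda$ on $\mathbb X$, $\Pi_\lambda$ denotes the distribution (on $\mathbf N$) of a Poisson process with intensity measure $\lambda$. $\Phi:\Omega\to\mathbf N$ is a fixed measurable map on a measurable space $\Omega$, and $\mathbb P_\lambda$ is a probability measure on $\Omega$ with $\mathbb P_\lambda(\Phi\in\cdot)=\Pi_\lambda$; $\mathbb E_\lambda$ is the corresponding expectation. For $f:\mathbf N\to\mathbb R$ measurable, $n\in\mathbb N$ and $x_1,\ldots,x_n\in\mathbb X$, $$D^n_{x_1,\ldots,x_n}f(\varphi)=\sum_{J\subset\{1,\ldots,n\}}(-1)^{n-|J|}f\Big(\varphi+\sum_{j\in J}\delta_{x_j}\Big).$$ Let $\rho$ be any $\sigma$-finite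 measure dominating $\lambda$ and $\nu$, with densities $h_\lambda:=\mathrm d\lambda/\mathrm d\rho$, $h_\nu:=\mathrm d\nu/\mathrm d\rho$. Then $\int g\,\mathrm d(\nu-\lambda)^n:=\int g(x_1,\ldots,x_n)\prod_{j=1}^n(h_\nu(x_j)-h_\lambda(x_j))\,\rho^n(\mathrm d(x_1,\ldots,x_n))$, and the squared Hellinger distance is $H(\lambda,\nu):=\frac12\int(\sqrt{h_\lambda}-\sqrt{h_\nu})^2\,\mathrm d\rho$. Both definitions are independent of the choice of $\rho$. *)

theory Defs
  imports "HOL-Probability.Probability"
begin

text \<open>The space \<open>\<^bold>N\<close> of \<open>\<sigma>\<close>-finite, \<open>{0,1,2,\<dots>} \<union> {\<infinity>}\<close>-valued measures on \<open>X\<close>, with the smallest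
  \<open>\<sigma>\<close>-field making all evaluations \<open>\<phi> \<mapsto> \<phi>(B)\<close> measurable (compare \<^const>\<open>subprob_algebra\<close>).\<close>

definition counting_measures :: "'a measure \<Rightarrow> 'a measure set" where
  "counting_measures X =
    {\<phi>. sets \<phi> = sets X \<and> sigma_finite_measure \<phi> \<and>
        (\<forall>B\<in>sets X. emeasure \<phi> B \<in> insert \<infinity> (range of_nat))}"

definition point_space :: "'a measure \<Rightarrow> 'a measure measure" where
  "point_space X =
    (SUP B \<in> sets X. vimage_algebra (counting_measures X) (\<lambda>\<phi>. emeasure \<phi> B) borel)"

lemma space_point_space: "space (point_space X) = counting_measures X"
  by (auto simp: point_space_def space_Sup_eq_UN)

lemma measurable_emeasure_point_space:
  "B \<in> sets X \<Longrightarrow> (\<lambda>\<phi>. emeasure \<phi> B) \<in> borel_measurable (point_space X)"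
  by (auto intro!: measurable_Sup1 measurable_vimage_algebra1 simp: point_space_def)

text \<open>\<open>P\<close> is the distribution of a Poisson process with intensity measure \<open>\<mu>\<close>; these two defining properties
  determine \<open>P\<close> uniquely. In the first one \<open>0 ^ 0 = 1\<close>, so \<open>\<phi>(B) = 0\<close> a.s. when \<open>\<mu>(B) = 0\<close>.\<close>

definition poisson_process_law :: "'a measure \<Rightarrow> 'a measure \<Rightarrow> 'a measure measure \<Rightarrow> bool" where
  "poisson_process_law X \<mu> P \<longleftrightarrow>
    prob_space P \<and> sets P = sets (point_space X) \<and>
    (\<forall>B\<in>sets X.
      (if emeasure \<mu> B = \<infinity> then (AE \<phi> in P. emeasure \<phi> B = \<infinity>)
       else (\<forall>k::nat. measure P {\<phi> \<in> space P. emeasure \<phi> B = of_nat k} =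
             exp (- measure \<mu> B) * measure \<mu> B ^ k / fact k))) \<and>
    (\<forall>m (B :: nat \<Rightarrow> 'a set). (\<forall>i<m. B i \<in> sets X) \<and> disjoint_family_on B {..<m} \<longrightarrow>
      prob_space.indep_vars P (\<lambda>_. borel) (\<lambda>i \<phi>. emeasure \<phi> (B i)) {..<m})"

text \<open>\<open>\<phi> + (\<Sum>j\<in>J. \<delta>\<^bsub>x j\<^esub>)\<close>\<close>

definition add_points :: "'a measure \<Rightarrow> (nat \<Rightarrow> 'a) \<Rightarrow> nat set \<Rightarrow> 'a measure" where
  "add_points \<phi> x J =
    measure_of (space \<phi>) (sets \<phi>) (\<lambda>B. emeasure \<phi> B + (\<Sum>j\<in>J. emeasure (return \<phi> (x j)) B))"

lemma sets_add_points [simp]: "sets (add_points \<phi> x J) = sets \<phi>"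
  and space_add_points [simp]: "space (add_points \<phi> x J) = space \<phi>"
  by (simp_all add: add_points_def)

lemma emeasure_add_points:
  assumes "B \<in> sets \<phi>"
  shows "emeasure (add_points \<phi> x J) B =
    emeasure \<phi> B + (\<Sum>j\<in>J. emeasure (return \<phi> (x j)) B)"
proof (rule emeasure_measure_of[OF add_points_def])
  show "countably_additive (sets (add_points \<phi> x J))
     (\<lambda>B. emeasure \<phi> B + (\<Sum>j\<in>J. emeasure (return \<phi> (x j)) B))"
  proof (rule countably_additiveI)
    fix A :: "nat \<Rightarrow> 'a set"
    assume A: "range A \<subseteq> sets (add_points \<phi> x J)" "disjoint_family A"
    have "(\<Sum>i. emeasure \<phi> (A i) + (\<Sum>j\<in>J. emeasure (return \<phi> (x j)) (A i))) =
      (\<Sum>i. emeasure \<phi> (A i)) + (\<Sum>j\<in>J. \<Sum>i. emeasure (return \<phi> (x j)) (A i))"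
      by (subst suminf_add[symmetric]) (auto simp: suminf_sum)
    also have "\<dots> = emeasure \<phi> (\<Union>i. A i) + (\<Sum>j\<in>J. emeasure (return \<phi> (x j)) (\<Union>i. A i))"
      using A by (intro arg_cong2[where f="(+)"] sum.cong refl suminf_emeasure) auto
    finally show "(\<Sum>i. emeasure \<phi> (A i) + (\<Sum>j\<in>J. emeasure (return \<phi> (x j)) (A i))) =
      emeasure \<phi> (\<Union>i. A i) + (\<Sum>j\<in>J. emeasure (return \<phi> (x j)) (\<Union>i. A i))" .
  qed
qed (use assms sets.sets_into_space in \<open>auto simp: positive_def\<close>)

text \<open>\<open>D\<^sup>n\<^bsub>x 1,\<dots>,x n\<^esub> f(\<phi>)\<close>\<close>

definition difference_op ::
    "nat \<Rightarrow> (nat \<Rightarrow> 'a) \<Rightarrow> ('a measure \<Rightarrow> real) \<Rightarrow> 'a measure \<Rightarrow> real" where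
  "difference_op n x f \<phi> =
    (\<Sum>J\<in>Pow {1..n}. (- 1) ^ (n - card J) * f (add_points \<phi> x J))"

text \<open>A finite version of the density \<open>d\<mu>/d\<rho>\<close>. For \<open>\<sigma>\<close>-finite \<open>\<mu>\<close>, \<^const>\<open>RN_deriv\<close> is
  \<open>\<infinity>\<close> only on a \<open>\<rho>\<close>-null set.\<close>

definition rdensity :: "'a measure \<Rightarrow> 'a measure \<Rightarrow> 'a \<Rightarrow> real" where
  "rdensity \<rho> \<mu> x = enn2real (RN_deriv \<rho> \<mu> x)"

text \<open>Integration with respect to \<open>(\<nu> - \<mu>)\<^sup>n\<close> and the squared Hellinger distance, expressed by
  a \<open>\<sigma>\<close>-finite measure \<open>\<rho>\<close> dominating \<open>\<mu>\<close> and \<open>\<nu>\<close>; neither depends on its choice.\<close>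

definition diff_power_integrable ::
    "'a measure \<Rightarrow> 'a measure \<Rightarrow> 'a measure \<Rightarrow> nat \<Rightarrow> ((nat \<Rightarrow> 'a) \<Rightarrow> real) \<Rightarrow> bool" where
  "diff_power_integrable \<rho> \<nu> \<mu> n g \<longleftrightarrow>
    integrable (PiM {1..n} (\<lambda>_. \<rho>))
      (\<lambda>x. g x * (\<Prod>j\<in>{1..n}. rdensity \<rho> \<nu> (x j) - rdensity \<rho> \<mu> (x j)))"

definition diff_power_integral ::
    "'a measure \<Rightarrow> 'a measure \<Rightarrow> 'a measure \<Rightarrow> nat \<Rightarrow> ((nat \<Rightarrow> 'a) \<Rightarrow> real) \<Rightarrow> real" where
  "diff_power_integral \<rho> \<nu> \<mu> n g =
    (\<integral>x. g x * (\<Prod>j\<in>{1..n}. rdensity \<rho> \<nu> (x j) - rdensity \<rho> \<mu> (x j))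
      \<partial>PiM {1..n} (\<lambda>_. \<rho>))"

definition hellinger_sq :: "'a measure \<Rightarrow> 'a measure \<Rightarrow> 'a measure \<Rightarrow> ennreal" where
  "hellinger_sq \<rho> \<mu> \<nu> =
    ennreal (1/2) *
    (\<integral>\<^sup>+x. ennreal ((sqrt (rdensity \<rho> \<mu> x) - sqrt (rdensity \<rho> \<nu> x))\<^sup>2) \<partial>\<rho>)"

definition mutually_singular :: "'b measure \<Rightarrow> 'b measure \<Rightarrow> bool" where
  "mutually_singular P Q \<longleftrightarrow>
    sets P = sets Q \<and> (\<exists>A\<in>sets P. emeasure P A = 0 \<and> emeasure Q (space Q - A) = 0)"

end

theory Submission
  imports Defs
begin

text \<open>Let \<open>A\<close> be the set where \<open>h\<^sub>\<mu> = 0 < h\<^sub>\<nu>\<close>. If the laws were singular, there would be an event \<open>F\<close> with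
  \<open>\<Pi>\<^sub>\<mu>(F) = 0 < \<Pi>\<^sub>\<nu>(F)\<close> that adding points of \<open>A\<close> cannot lead into: \<open>{\<phi>(A) = \<infinity>}\<close> if \<open>\<nu>(A) = \<infinity>\<close>, and
  otherwise a separating event intersected with \<open>{\<phi>(A) = 0}\<close>. By the Mecke equation, adding
  \<open>\<mu>\<close>-almost any point to a \<open>\<Pi>\<^sub>\<mu>\<close>-process avoids a null event. So every term of the expansion of
  \<open>f = 1\<^sub>F\<close> vanishes: for almost every tuple of points either \<open>h\<^sub>\<nu> - h\<^sub>\<mu>\<close> is zero at one of them, or adding
  any of them almost surely avoids \<open>F\<close>. This contradicts \<open>\<Pi>\<^sub>\<nu>(F) > 0\<close>.

  Finiteness of the Hellinger distance follows from nonsingularity. With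
  \<open>g = (h\<^sub>\<nu> - h\<^sub>\<mu>) / (4 (h\<^sub>\<mu> + h\<^sub>\<nu>))\<close>, Chernoff bounds for \<open>\<integral>\<^bsub>C\<^esub> g d\<phi>\<close> separate the two laws up to error
  \<open>exp (- V / 32)\<close>, where \<open>V = \<integral>\<^bsub>C\<^esub> (h\<^sub>\<nu> - h\<^sub>\<mu>)\<^sup>2 / (h\<^sub>\<mu> + h\<^sub>\<nu>) d\<rho>\<close> dominates the Hellinger integral over
  \<open>C\<close>. If that integral diverges, the Borel-Cantelli lemma yields singularity.\<close>

section \<open>Adding points and cylinder events\<close>

lemma measurable_point_spaceI:
  assumes "\<And>w. w \<in> space M \<Longrightarrow> g w \<in> counting_measures X"
    and "\<And>B. B \<in> sets X \<Longrightarrow> (\<lambda>w. emeasure (g w) B) \<in> borel_measurable M"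
  shows "g \<in> measurable M (point_space X)"
  using assms by (auto intro!: measurable_Sup2 measurable_vimage_algebra2 simp: point_space_def)

lemma add_points_in_counting_measures:
  assumes "\<phi> \<in> counting_measures X"
  shows "add_points \<phi> x J \<in> counting_measures X"
proof -
  have sets: "sets \<phi> = sets X" and sf: "sigma_finite_measure \<phi>"
    and val: "\<And>B. B \<in> sets X \<Longrightarrow> emeasure \<phi> B \<in> insert \<infinity> (range of_nat)"
    using assms by (auto simp: counting_measures_def)
  interpret sigma_finite_measure \<phi> by fact
  \<comment> \<open>The increment is a natural number, 0 by convention if \<open>J\<close> is
    infinite. Finite counts therefore stay finite, and the sets exhausting the space for
    \<open>\<phi>\<close> also serve for the enlarged measure.\<close>
  have e: "emeasure (add_points \<phi> x J) B = emeasure \<phi> B + of_nat (\<Sum>j\<in>J. indicator B (x j))"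
    if "B \<in> sets \<phi>" for B
    using that by (simp add: emeasure_add_points indicator_def of_nat_sum if_distrib cong: if_cong)
  have "sigma_finite_measure (add_points \<phi> x J)"
  proof
    obtain A where A: "countable A" "A \<subseteq> sets \<phi>" "\<Union>A = space \<phi>" "\<forall>a\<in>A. emeasure \<phi> a \<noteq> \<infinity>"
      using sigma_finite_countable by blast
    have "\<forall>a\<in>A. emeasure (add_points \<phi> x J) a \<noteq> \<infinity>"
      using A(2,4) by (auto simp: e subset_iff simp del: of_nat_sum)
    then show "\<exists>A. countable A \<and> A \<subseteq> sets (add_points \<phi> x J) \<and> \<Union>A = space (add_points \<phi> x J) \<and>
        (\<forall>a\<in>A. emeasure (add_points \<phi> x J) a \<noteq> \<infinity>)"
      using A by (intro exI[of _ A]) auto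
  qed
  moreover have "emeasure (add_points \<phi> x J) B \<in> insert \<infinity> (range of_nat)" if "B \<in> sets X" for B
    using val[OF that] that sets by (auto simp: e simp del: of_nat_sum simp flip: of_nat_add)
  ultimately show ?thesis
    using sets by (auto simp: counting_measures_def)
qed

lemma measurable_add_points:
  assumes h: "h \<in> measurable M (point_space X)"
    and g: "\<And>j. j \<in> J \<Longrightarrow> (\<lambda>w. g w j) \<in> measurable M X"
  shows "(\<lambda>w. add_points (h w) (g w) J) \<in> measurable M (point_space X)"
proof (rule measurable_point_spaceI)
  fix w assume "w \<in> space M"
  then show "add_points (h w) (g w) J \<in> counting_measures X"
    using measurable_space[OF h] by (simp add: add_points_in_counting_measures space_point_space)
next
  fix B assume B: "B \<in> sets X"
  \<comment> \<open>In indicator form the summands no longer involve the measure \<open>h w\<close>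
    through \<open>return\<close>, so they depend on \<open>w\<close> through the measurable points
    \<open>g w j\<close> alone.\<close>
  have "(\<lambda>w. emeasure (h w) B + (\<Sum>j\<in>J. indicator B (g w j)) :: ennreal) \<in> borel_measurable M"
    using B g measurable_compose[OF h measurable_emeasure_point_space[OF B]]
    by (intro borel_measurable_add borel_measurable_sum) (auto intro: measurable_compose)
  also have "?this \<longleftrightarrow> (\<lambda>w. emeasure (add_points (h w) (g w) J) B) \<in> borel_measurable M"
    using B measurable_space[OF h]
    by (intro measurable_cong) (auto simp: emeasure_add_points space_point_space counting_measures_def)
  finally show "(\<lambda>w. emeasure (add_points (h w) (g w) J) B) \<in> borel_measurable M" .
qed

abbreviation add_point :: "'a measure \<Rightarrow> 'a \<Rightarrow> 'a measure" where
  "add_point \<phi> x \<equiv> add_points \<phi> (\<lambda>_. x) {0}"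

lemma emeasure_add_point:
  "B \<in> sets \<phi> \<Longrightarrow> emeasure (add_point \<phi> x) B = emeasure \<phi> B + indicator B x"
  by (simp add: emeasure_add_points)

lemma measurable_add_point:
  assumes "h \<in> measurable M (point_space X)" "g \<in> measurable M X"
  shows "(\<lambda>w. add_point (h w) (g w)) \<in> measurable M (point_space X)"
  using assms by (intro measurable_add_points) auto

lemma add_points_empty: "add_points \<phi> x {} = \<phi>"
  by (rule measure_eqI) (simp_all add: emeasure_add_points)

text \<open>Peels off one coordinate. The updated tuple \<open>x(i := y)\<close> is the shape in
  which iterated integration over a product measure presents the points.\<close>

lemma add_points_insert:
  assumes "finite J" "i \<notin> J"
  shows "add_points \<phi> (x(i := y)) (insert i J) = add_point (add_points \<phi> x J) y"
proof (rule measure_eqI)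
  fix B assume "B \<in> sets (add_points \<phi> (x(i := y)) (insert i J))"
  moreover have "(\<Sum>j\<in>J. indicator B ((x(i := y)) j)) = (\<Sum>j\<in>J. indicator B (x j) :: ennreal)"
    using assms by (intro sum.cong) auto
  ultimately show "emeasure (add_points \<phi> (x(i := y)) (insert i J)) B =
      emeasure (add_point (add_points \<phi> x J) y) B"
    using assms by (simp add: emeasure_add_points add_ac)
qed simp

lemma add_points_upd_notin: "i \<notin> J \<Longrightarrow> add_points \<phi> (x(i := y)) J = add_points \<phi> x J"
  by (rule measure_eqI) (auto simp: emeasure_add_points intro!: arg_cong2[where f="(+)"] sum.cong)

lemma add_point_commute: "add_point (add_point \<phi> x) y = add_point (add_point \<phi> y) x"
  by (rule measure_eqI) (simp_all add: emeasure_add_points add_ac)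

section \<open>Finite-dimensional events and uniqueness of measures on the point space\<close>

definition cylinders :: "'a measure \<Rightarrow> 'a measure set set" where
  "cylinders X = {{\<phi> \<in> counting_measures X. \<forall>(B, C)\<in>\<F>. emeasure \<phi> B \<in> C} | \<F>.
    finite \<F> \<and> \<F> \<subseteq> sets X \<times> sets borel}"

lemma cylinders_subset: "cylinders X \<subseteq> sets (point_space X)"
proof
  fix A assume "A \<in> cylinders X"
  then obtain \<F> where F: "finite \<F>" "\<F> \<subseteq> sets X \<times> sets borel"
    and A: "A = {\<phi> \<in> counting_measures X. \<forall>(B, C)\<in>\<F>. emeasure \<phi> B \<in> C}"
    by (auto simp: cylinders_def)
  have "{\<phi> \<in> space (point_space X). emeasure \<phi> B \<in> C} \<in> sets (point_space X)"
    if "(B, C) \<in> \<F>" for B C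
    using measurable_sets[OF measurable_emeasure_point_space[of B X], of C] F that
    by (auto simp: vimage_def Int_def conj_commute)
  then have "{\<phi> \<in> space (point_space X). \<forall>p\<in>\<F>. emeasure \<phi> (fst p) \<in> snd p} \<in> sets (point_space X)"
    using F by (intro sets.sets_Collect_finite_All) auto
  then show "A \<in> sets (point_space X)"
    by (simp add: A space_point_space case_prod_beta)
qed

lemma Int_stable_cylinders: "Int_stable (cylinders X)"
proof (rule Int_stableI)
  fix A1 A2 assume "A1 \<in> cylinders X" "A2 \<in> cylinders X"
  then obtain \<F> \<G> where "finite \<F>" "\<F> \<subseteq> sets X \<times> sets borel" "finite \<G>" "\<G> \<subseteq> sets X \<times> sets borel"
    "A1 = {\<phi> \<in> counting_measures X. \<forall>(B, C)\<in>\<F>. emeasure \<phi> B \<in> C}"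
    "A2 = {\<phi> \<in> counting_measures X. \<forall>(B, C)\<in>\<G>. emeasure \<phi> B \<in> C}"
    by (auto simp: cylinders_def)
  then show "A1 \<inter> A2 \<in> cylinders X"
    by (auto simp: cylinders_def intro!: exI[of _ "\<F> \<union> \<G>"])
qed

text \<open>Cylinders are finite intersections of measurable count events. Conversely, events about
  a single count are cylinders, so the identity is measurable from the sigma-algebra they generate
  into the point space.\<close>

lemma sets_point_space_eq_cylinders:
  "sets (point_space X) = sigma_sets (counting_measures X) (cylinders X)"
proof
  have sub: "cylinders X \<subseteq> Pow (counting_measures X)"
    by (auto simp: cylinders_def)
  show "sigma_sets (counting_measures X) (cylinders X) \<subseteq> sets (point_space X)"
    using sets.sigma_sets_subset[OF cylinders_subset] by (simp add: space_point_space)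
  let ?S = "sigma (counting_measures X) (cylinders X)"
  have "(\<lambda>\<phi>. \<phi>) \<in> measurable ?S (point_space X)"
  proof (rule measurable_point_spaceI)
    fix B assume B: "B \<in> sets X"
    show "(\<lambda>\<phi>. emeasure \<phi> B) \<in> borel_measurable ?S"
    proof (rule measurableI)
      fix C :: "ennreal set" assume "C \<in> sets borel"
      then have "{\<phi> \<in> counting_measures X. emeasure \<phi> B \<in> C} \<in> cylinders X"
        using B unfolding cylinders_def by (intro CollectI exI[of _ "{(B, C)}"]) auto
      moreover have "(\<lambda>\<phi>. emeasure \<phi> B) -` C \<inter> space ?S = {\<phi> \<in> counting_measures X. emeasure \<phi> B \<in> C}"
        using sub by (auto simp: space_measure_of)
      ultimately show "(\<lambda>\<phi>. emeasure \<phi> B) -` C \<inter> space ?S \<in> sets ?S"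
        using sub by (simp add: sets_measure_of)
    qed simp
  qed (simp add: sub)
  then have "sets (point_space X) \<subseteq> sets ?S"
    using measurable_sets[of "\<lambda>\<phi>. \<phi>" ?S "point_space X"] sets.sets_into_space[of _ "point_space X"]
    by (auto simp: sub space_point_space Int_absorb2)
  then show "sets (point_space X) \<subseteq> sigma_sets (counting_measures X) (cylinders X)"
    using sub by (simp add: sets_measure_of)
qed

text \<open>The cells are the atoms of the generated finite algebra: each collects the points with
  one membership pattern \<open>S\<close> \<subseteq> \<open>\<B>\<close>. Counts of overlapping
  sets are not independent, but counts of cells are, and the former are sums of the latter.\<close>

lemma finite_partition_refining:
  assumes "finite \<B>" "\<B> \<subseteq> sets M"
  obtains \<D> where "finite \<D>" "\<D> \<subseteq> sets M" "disjoint \<D>" "\<forall>B\<in>\<B>. B = \<Union>{d \<in> \<D>. d \<subseteq> B}"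
proof
  let ?s = "\<lambda>S. {y \<in> space M. \<forall>B\<in>\<B>. y \<in> B \<longleftrightarrow> B \<in> S}"
  let ?\<D> = "?s ` Pow \<B>"
  show "finite ?\<D>"
    using assms by simp
  have part: "{y \<in> space M. (y \<in> B) = (B \<in> S)} \<in> sets M" if "B \<in> \<B>" for B S
  proof (cases "B \<in> S")
    case True
    then show ?thesis using that assms(2) sets.Int_space_eq2[of B M]
      by (auto simp: Collect_conj_eq Int_commute)
  next
    case False
    then have "{y \<in> space M. (y \<in> B) = (B \<in> S)} = space M - B" by auto
    then show ?thesis using that assms(2) by auto
  qed
  have "?s S \<in> sets M" for S
    using part assms(1) by (rule sets.sets_Collect_finite_All[where P="\<lambda>B y. (y \<in> B) = (B \<in> S)"])
  then show "?\<D> \<subseteq> sets M"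
    by blast
  show "disjoint ?\<D>"
  proof (rule disjointI)
    fix a b assume "a \<in> ?\<D>" "b \<in> ?\<D>" and ne: "a \<noteq> b"
    then obtain S T where ab: "a = ?s S" "b = ?s T" by (elim imageE)
    {
      fix x assume "x \<in> a" "x \<in> b"
      then have "\<forall>B\<in>\<B>. B \<in> S \<longleftrightarrow> B \<in> T" using ab by simp
      then have "a = b" unfolding ab by (intro Collect_cong conj_cong ball_cong refl) simp
    }
    with ne show "a \<inter> b = {}" by blast
  qed
  show "\<forall>B\<in>\<B>. B = \<Union>{d \<in> ?\<D>. d \<subseteq> B}"
  proof (intro ballI equalityI subsetI)
    fix B x assume B: "B \<in> \<B>" and x: "x \<in> B"
    let ?S = "{C \<in> \<B>. x \<in> C}"
    have "x \<in> space M" using x B assms(2) sets.sets_into_space by blast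
    then have "x \<in> ?s ?S" by simp
    moreover have "?s ?S \<subseteq> B" using B x by blast
    moreover have "?s ?S \<in> ?\<D>" by (rule imageI) blast
    ultimately show "x \<in> \<Union>{d \<in> ?\<D>. d \<subseteq> B}" by (intro UnionI[of "?s ?S"]) simp_all
  next
    fix B x assume "x \<in> \<Union>{d \<in> ?\<D>. d \<subseteq> B}"
    then show "x \<in> B" by blast
  qed
qed

lemma emeasure_eq_sum_parts:
  assumes "finite \<D>" "\<D> \<subseteq> sets M" "disjoint \<D>" "B = \<Union>{d \<in> \<D>. d \<subseteq> B}"
  shows "emeasure M B = (\<Sum>d | d \<in> \<D> \<and> d \<subseteq> B. emeasure M d)"
proof -
  have "(\<Sum>d\<in>{d \<in> \<D>. d \<subseteq> B}. emeasure M (id d)) = emeasure M (\<Union>d\<in>{d \<in> \<D>. d \<subseteq> B}. id d)"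
    using assms(1-3) by (intro sum_emeasure) (auto simp: disjoint_family_on_def disjoint_def)
  then show ?thesis
    using assms(4) by simp
qed

text \<open>The joint law of finitely many counts lives on a countable set, so it is determined by its atoms.\<close>

lemma point_space_measure_eqI:
  assumes fin: "emeasure M (space M) \<noteq> \<infinity>"
    and sets: "sets M = sets (point_space X)" "sets N = sets (point_space X)"
    and B\<^sub>0: "B\<^sub>0 \<in> sets X"
    and eq: "\<And>\<D> k. \<lbrakk>finite \<D>; \<D> \<subseteq> sets X; disjoint \<D>; B\<^sub>0 = \<Union>{d \<in> \<D>. d \<subseteq> B\<^sub>0}\<rbrakk> \<Longrightarrow>
      emeasure M {\<phi> \<in> counting_measures X. \<forall>d\<in>\<D>. emeasure \<phi> d = k d} =
      emeasure N {\<phi> \<in> counting_measures X. \<forall>d\<in>\<D>. emeasure \<phi> d = k d}"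
  shows "M = N"
proof (rule measure_eqI_generator_eq[OF Int_stable_cylinders])
  show "cylinders X \<subseteq> Pow (counting_measures X)"
    by (auto simp: cylinders_def)
  show "sets M = sigma_sets (counting_measures X) (cylinders X)"
    "sets N = sigma_sets (counting_measures X) (cylinders X)"
    using sets by (simp_all add: sets_point_space_eq_cylinders)
  show "range (\<lambda>_::nat. counting_measures X) \<subseteq> cylinders X"
    by (auto simp: cylinders_def intro!: exI[of _ "{}"])
  have "space M = counting_measures X"
    using sets_eq_imp_space_eq[OF sets(1)] by (simp add: space_point_space)
  then show "\<And>i. emeasure M (counting_measures X) \<noteq> \<infinity>"
    using fin by simp
  fix A assume "A \<in> cylinders X"
  then obtain \<F> where F: "finite \<F>" "\<F> \<subseteq> sets X \<times> sets borel"
    and A: "A = {\<phi> \<in> counting_measures X. \<forall>(B, C)\<in>\<F>. emeasure \<phi> B \<in> C}"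
    by (auto simp: cylinders_def)
  \<comment> \<open>The set \<open>B\<^sub>0\<close> joins the family to be refined, so that it
    becomes a union of cells, as the premise of \<open>eq\<close> demands.\<close>
  have "finite (insert B\<^sub>0 (fst ` \<F>))" "insert B\<^sub>0 (fst ` \<F>) \<subseteq> sets X"
    using F B\<^sub>0 by auto
  then obtain \<D> where D: "finite \<D>" "\<D> \<subseteq> sets X" "disjoint \<D>"
    and DB: "\<forall>B\<in>insert B\<^sub>0 (fst ` \<F>). B = \<Union>{d \<in> \<D>. d \<subseteq> B}"
    by (rule finite_partition_refining)
  have sum: "emeasure \<phi> B = (\<Sum>d | d \<in> \<D> \<and> d \<subseteq> B. emeasure \<phi> d)"
    if "\<phi> \<in> counting_measures X" "(B, C) \<in> \<F>" for \<phi> B C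
  proof (rule emeasure_eq_sum_parts)
    have "B \<in> insert B\<^sub>0 (fst ` \<F>)"
      using that(2) by (intro insertI2 image_eqI[of _ _ "(B, C)"]) simp_all
    with DB show "B = \<Union>{d \<in> \<D>. d \<subseteq> B}" by (rule bspec)
  qed (use that(1) D in \<open>auto simp: counting_measures_def\<close>)
  \<comment> \<open>\<open>K\<close> lists the vectors of cell counts compatible with the
    constraints. It is countable because counts are natural numbers or infinite and there are
    finitely many cells; \<open>PiE\<close> makes distinct vectors differ on some cell, so their
    events are disjoint.\<close>
  define K :: "('a set \<Rightarrow> ennreal) set" where
    "K = {k \<in> PiE \<D> (\<lambda>_. insert \<infinity> (range of_nat)). \<forall>(B, C)\<in>\<F>. (\<Sum>d | d \<in> \<D> \<and> d \<subseteq> B. k d) \<in> C}"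
  define E where "E k = {\<phi> \<in> counting_measures X. \<forall>d\<in>\<D>. emeasure \<phi> d = k d}" for k
  have "countable (PiE \<D> (\<lambda>_. insert \<infinity> (range of_nat) :: ennreal set))"
    by (intro countable_PiE D) auto
  then have "countable K"
    by (rule countable_subset[rotated]) (auto simp: K_def)
  have Esets: "E k \<in> sets (point_space X)" for k
  proof -
    have "E k = {\<phi> \<in> counting_measures X. \<forall>(B, C)\<in>(\<lambda>d. (d, {k d})) ` \<D>. emeasure \<phi> B \<in> C}"
      by (auto simp: E_def)
    then have "E k \<in> cylinders X"
      unfolding cylinders_def using D by (intro CollectI exI[of _ "(\<lambda>d. (d, {k d})) ` \<D>"]) auto
    then show ?thesis
      using cylinders_subset by blast
  qed
  have disj: "disjoint_family_on E K"
    unfolding disjoint_family_on_def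
  proof (intro ballI impI)
    fix k l assume "k \<in> K" "l \<in> K" "k \<noteq> l"
    then obtain d where "d \<in> \<D>" "k d \<noteq> l d"
      unfolding K_def by (metis (mono_tags, lifting) PiE_ext mem_Collect_eq)
    then show "E k \<inter> E l = {}"
      by (auto simp: E_def)
  qed
  have "A = (\<Union>k\<in>K. E k)"
  proof (intro equalityI subsetI)
    fix \<phi> assume "\<phi> \<in> A"
    then have phi: "\<phi> \<in> counting_measures X" "\<forall>(B, C)\<in>\<F>. emeasure \<phi> B \<in> C"
      by (auto simp: A)
    let ?k = "restrict (emeasure \<phi>) \<D>"
    have "(\<Sum>d | d \<in> \<D> \<and> d \<subseteq> B. ?k d) \<in> C" if BC: "(B, C) \<in> \<F>" for B C
    proof -
      have "(\<Sum>d | d \<in> \<D> \<and> d \<subseteq> B. ?k d) = emeasure \<phi> B"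
        by (subst sum[OF phi(1) BC]) (auto intro!: sum.cong)
      then show ?thesis using phi(2) BC by auto
    qed
    moreover have "emeasure \<phi> d \<in> insert \<infinity> (range of_nat)" if "d \<in> \<D>" for d
      using phi(1) D(2) that unfolding counting_measures_def by blast
    ultimately have "?k \<in> K"
      unfolding K_def by (intro CollectI conjI PiE_I) (auto simp del: infinity_ennreal_def)
    moreover have "\<phi> \<in> E ?k"
      using phi by (auto simp: E_def)
    ultimately show "\<phi> \<in> (\<Union>k\<in>K. E k)" by blast
  next
    fix \<phi> assume "\<phi> \<in> (\<Union>k\<in>K. E k)"
    then obtain k where k: "k \<in> K" "\<phi> \<in> E k" by blast
    then have phi: "\<phi> \<in> counting_measures X"
      by (auto simp: E_def)
    have "emeasure \<phi> B \<in> C" if BC: "(B, C) \<in> \<F>" for B C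
    proof -
      have "emeasure \<phi> B = (\<Sum>d | d \<in> \<D> \<and> d \<subseteq> B. k d)"
        using k(2) by (subst sum[OF phi BC]) (auto simp: E_def intro!: sum.cong)
      then show ?thesis
        using k(1) BC unfolding K_def by auto
    qed
    then show "\<phi> \<in> A"
      using phi unfolding A by blast
  qed
  moreover have "emeasure M (\<Union>k\<in>K. E k) = emeasure N (\<Union>k\<in>K. E k)"
    using \<open>countable K\<close> disj Esets sets eq[OF D DB[rule_format, OF insertI1]]
    by (subst (1 2) emeasure_UN_countable) (auto simp: E_def)
  ultimately show "emeasure M A = emeasure N A"
    by simp
qed (auto simp: space_point_space)

section \<open>The Mecke equation\<close>

lemma (in prob_space) indep_vars_reindex:
  assumes inj: "inj_on g I" and ind: "indep_vars N Y (g ` I)"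
  shows "indep_vars (\<lambda>i. N (g i)) (\<lambda>i. Y (g i)) I"
  unfolding indep_vars_def2 indep_sets_def
proof (intro conjI ballI allI impI)
  let ?F = "\<lambda>i. {Y i -` A \<inter> space M |A. A \<in> sets (N i)}"
  show "random_variable (N (g i)) (Y (g i))" if "i \<in> I" for i
    using ind that by (simp add: indep_vars_def2)
  show "?F (g i) \<subseteq> events" if "i \<in> I" for i
    using ind that by (simp add: indep_vars_def2 indep_sets_def)
  fix J A assume J: "J \<subseteq> I" "J \<noteq> {}" "finite J" and A: "A \<in> (\<Pi> i\<in>J. ?F (g i))"
  let ?A = "\<lambda>j. A (the_inv_into J g j)"
  have injJ: "inj_on g J"
    using inj J(1) by (rule inj_on_subset)
  then have inv: "the_inv_into J g (g j) = j" if "j \<in> J" for j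
    using that by (rule the_inv_into_f_f)
  have "?A \<in> Pi (g ` J) ?F"
    using A inv by (auto simp: Pi_iff)
  moreover have "g ` J \<subseteq> g ` I" "g ` J \<noteq> {}" "finite (g ` J)"
    using J by auto
  ultimately have "prob (\<Inter>j\<in>g ` J. ?A j) = (\<Prod>j\<in>g ` J. prob (?A j))"
    using ind unfolding indep_vars_def2 indep_sets_def by blast
  moreover have "(\<Inter>j\<in>g ` J. ?A j) = (\<Inter>j\<in>J. A j)"
    using inv by auto
  moreover have "(\<Prod>j\<in>g ` J. prob (?A j)) = (\<Prod>j\<in>J. prob (A j))"
    using inv by (subst prod.reindex[OF injJ]) simp
  ultimately show "prob (\<Inter>j\<in>J. A j) = (\<Prod>j\<in>J. prob (A j))"
    by simp
qed

section \<open>Joint and single counts of a Poisson process\<close>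

locale poisson_process = prob_space P + intensity: sigma_finite_measure \<mu>
  for X \<mu> :: "'a measure" and P :: "'a measure measure" +
  assumes sets_intensity: "sets \<mu> = sets X" and law: "poisson_process_law X \<mu> P"
begin

lemma sets_law: "sets P = sets (point_space X)"
  using law by (simp add: poisson_process_law_def)

lemma space_law: "space P = counting_measures X"
  using sets_eq_imp_space_eq[OF sets_law] by (simp add: space_point_space)

lemma measurable_count: "B \<in> sets X \<Longrightarrow> (\<lambda>\<phi>. emeasure \<phi> B) \<in> borel_measurable P"
  using measurable_emeasure_point_space measurable_cong_sets[OF sets_law refl] by blast

lemma count_values:
  "\<phi> \<in> space P \<Longrightarrow> B \<in> sets X \<Longrightarrow> emeasure \<phi> B \<in> insert \<infinity> (range of_nat)"
  by (auto simp: space_law counting_measures_def)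

lemma sets_count_event: "B \<in> sets X \<Longrightarrow> C \<in> sets borel \<Longrightarrow> {\<phi> \<in> space P. emeasure \<phi> B \<in> C} \<in> sets P"
  using measurable_sets[OF measurable_count, of B C] by (simp add: vimage_def Int_def conj_commute)

lemma indep_counts:
  assumes "finite \<D>" "\<D> \<subseteq> sets X" "disjoint \<D>"
  shows "indep_vars (\<lambda>_. borel) (\<lambda>d \<phi>. emeasure \<phi> d) \<D>"
proof -
  obtain h where h: "bij_betw h {..<card \<D>} \<D>"
    using ex_bij_betw_nat_finite[OF assms(1)] by (auto simp: atLeast0LessThan)
  define g where "g = the_inv_into {..<card \<D>} h"
  have g: "inj_on g \<D>" "g ` \<D> = {..<card \<D>}" "\<And>d. d \<in> \<D> \<Longrightarrow> h (g d) = d"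
    using bij_betw_the_inv_into[OF h] h f_the_inv_into_f_bij_betw[OF h]
    by (auto simp: g_def bij_betw_def)
  have "\<forall>i<card \<D>. h i \<in> sets X"
    using h assms(2) by (auto simp: bij_betw_def)
  moreover have "disjoint_family_on h {..<card \<D>}"
    using h assms(3) unfolding disjoint_family_on_def disjoint_def bij_betw_def
    by (metis imageI inj_onD)
  ultimately have "indep_vars (\<lambda>_. borel) (\<lambda>i \<phi>. emeasure \<phi> (h i)) (g ` \<D>)"
    using law by (simp add: poisson_process_law_def g(2))
  from indep_vars_reindex[OF g(1) this] show ?thesis
    by (rule indep_vars_cong[THEN iffD1, rotated -1]) (simp_all add: g(3))
qed

text \<open>The events enter as indicators: the expectation of a product of independent nonnegative
  variables factorises, also for the empty family.\<close>

lemma emeasure_joint_counts: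
  assumes D: "finite \<D>" "\<D> \<subseteq> sets X" "disjoint \<D>" and C: "\<And>d. d \<in> \<D> \<Longrightarrow> C d \<in> sets borel"
  shows "emeasure P {\<phi> \<in> space P. \<forall>d\<in>\<D>. emeasure \<phi> d \<in> C d} =
    (\<Prod>d\<in>\<D>. emeasure P {\<phi> \<in> space P. emeasure \<phi> d \<in> C d})"
proof -
  have ev: "{\<phi> \<in> space P. emeasure \<phi> d \<in> C d} \<in> sets P" if "d \<in> \<D>" for d
    using that D(2) C by (intro sets_count_event) auto
  have "indep_vars (\<lambda>_. borel) (\<lambda>d \<phi>. indicator (C d) (emeasure \<phi> d) :: ennreal) \<D>"
    using C by (intro indep_vars_compose2[OF indep_counts[OF D]]) auto
  from indep_vars_nn_integral[OF D(1) this]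
  have "(\<integral>\<^sup>+\<phi>. (\<Prod>d\<in>\<D>. indicator (C d) (emeasure \<phi> d)) \<partial>P) =
      (\<Prod>d\<in>\<D>. \<integral>\<^sup>+\<phi>. indicator (C d) (emeasure \<phi> d) \<partial>P)"
    by simp
  also have "(\<integral>\<^sup>+\<phi>. (\<Prod>d\<in>\<D>. indicator (C d) (emeasure \<phi> d)) \<partial>P) =
      (\<integral>\<^sup>+\<phi>. indicator {\<phi> \<in> space P. \<forall>d\<in>\<D>. emeasure \<phi> d \<in> C d} \<phi> \<partial>P)"
  proof (rule nn_integral_cong)
    fix \<phi> assume "\<phi> \<in> space P"
    then show "(\<Prod>d\<in>\<D>. indicator (C d) (emeasure \<phi> d)) =
      (indicator {\<phi> \<in> space P. \<forall>d\<in>\<D>. emeasure \<phi> d \<in> C d} \<phi> :: ennreal)"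
      using D(1) by (auto simp: indicator_def prod_zero_iff intro!: prod.neutral)
  qed
  also have "\<dots> = emeasure P {\<phi> \<in> space P. \<forall>d\<in>\<D>. emeasure \<phi> d \<in> C d}"
    by (intro nn_integral_indicator sets.sets_Collect_finite_All ev D)
  also have "(\<Prod>d\<in>\<D>. \<integral>\<^sup>+\<phi>. indicator (C d) (emeasure \<phi> d) \<partial>P) =
      (\<Prod>d\<in>\<D>. \<integral>\<^sup>+\<phi>. indicator {\<phi> \<in> space P. emeasure \<phi> d \<in> C d} \<phi> \<partial>P)"
    by (intro prod.cong nn_integral_cong) (auto simp: indicator_def)
  also have "\<dots> = (\<Prod>d\<in>\<D>. emeasure P {\<phi> \<in> space P. emeasure \<phi> d \<in> C d})"
    by (intro prod.cong nn_integral_indicator ev refl)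
  finally show ?thesis .
qed

lemma emeasure_count_eq:
  assumes "B \<in> sets X" "emeasure \<mu> B \<noteq> \<infinity>"
  shows "emeasure P {\<phi> \<in> space P. emeasure \<phi> B = of_nat k} =
    ennreal (exp (- measure \<mu> B) * measure \<mu> B ^ k / fact k)"
  using assms law by (simp add: poisson_process_law_def emeasure_eq_measure)

text \<open>The Poisson weights sum to \<open>exp (- ?m) * exp ?m = 1\<close>, so no mass is left
  for an infinite count.\<close>

lemma AE_count_finite:
  assumes B: "B \<in> sets X" "emeasure \<mu> B \<noteq> \<infinity>"
  shows "AE \<phi> in P. emeasure \<phi> B \<in> range of_nat"
proof -
  define E where "E k = {\<phi> \<in> space P. emeasure \<phi> B = of_nat k}" for k :: nat
  have E: "E k \<in> sets P" for k
    using sets_count_event[of B "{of_nat k}"] B by (simp add: E_def)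
  let ?m = "measure \<mu> B"
  have "disjoint_family E"
    by (auto simp: disjoint_family_on_def E_def)
  then have "emeasure P (\<Union>k. E k) = (\<Sum>k. emeasure P (E k))"
    using E by (intro suminf_emeasure[symmetric]) auto
  also have "\<dots> = (\<Sum>k. ennreal (exp (- ?m) * (?m ^ k /\<^sub>R fact k)))"
    unfolding E_def emeasure_count_eq[OF B] by (simp add: field_simps)
  also have "\<dots> = ennreal (exp (- ?m) * exp ?m)"
    by (intro suminf_ennreal_eq sums_mult exp_converges) simp
  also have "\<dots> = 1"
    by (simp flip: exp_add)
  finally have "AE \<phi> in P. \<phi> \<in> (\<Union>k. E k)"
    by (intro AE_prob_1) (simp add: measure_def)
  then show ?thesis
    by eventually_elim (auto simp: E_def)
qed

lemma AE_count_infinite: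
  assumes B: "B \<in> sets X" "emeasure \<mu> B = \<infinity>"
  shows "AE \<phi> in P. emeasure \<phi> B = \<infinity>"
proof -
  have "\<forall>B\<in>sets X. if emeasure \<mu> B = \<infinity> then (AE \<phi> in P. emeasure \<phi> B = \<infinity>)
      else (\<forall>k::nat. measure P {\<phi> \<in> space P. emeasure \<phi> B = of_nat k} =
        exp (- measure \<mu> B) * measure \<mu> B ^ k / fact k)"
    using law unfolding poisson_process_law_def by (elim conjE)
  from bspec[OF this B(1)] show ?thesis
    by (simp only: B(2) refl if_True)
qed

text \<open>Almost surely exactly one of the events \<open>E k\<close> occurs, so the series of
  indicators has a single possibly nonzero term and integrates to a series over the Poisson
  weights.\<close>

lemma nn_integral_count:
  assumes B: "B \<in> sets X" "emeasure \<mu> B \<noteq> \<infinity>"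
  shows "(\<integral>\<^sup>+\<phi>. h (emeasure \<phi> B) \<partial>P) =
    (\<Sum>k. h (of_nat k) * ennreal (exp (- measure \<mu> B) * measure \<mu> B ^ k / fact k))"
proof -
  define E where "E k = {\<phi> \<in> space P. emeasure \<phi> B = of_nat k}" for k :: nat
  have E: "E k \<in> sets P" for k
    using sets_count_event[of B "{of_nat k}"] B by (simp add: E_def)
  have "(\<integral>\<^sup>+\<phi>. h (emeasure \<phi> B) \<partial>P) = (\<integral>\<^sup>+\<phi>. (\<Sum>k. h (of_nat k) * indicator (E k) \<phi>) \<partial>P)"
  proof (rule nn_integral_cong_AE)
    show "AE \<phi> in P. h (emeasure \<phi> B) = (\<Sum>k. h (of_nat k) * indicator (E k) \<phi>)"
      using AE_count_finite[OF B] AE_space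
    proof eventually_elim
      case (elim \<phi>)
      then obtain n where "\<phi> \<in> E n" "emeasure \<phi> B = of_nat n"
        by (auto simp: E_def)
      then show ?case
        by (subst suminf_cmult_indicator) (auto simp: disjoint_family_on_def E_def)
    qed
  qed
  also have "\<dots> = (\<Sum>k. h (of_nat k) * emeasure P (E k))"
    using E by (subst nn_integral_suminf) (auto simp: nn_integral_cmult_indicator)
  finally show ?thesis
    by (simp add: E_def emeasure_count_eq[OF B])
qed

text \<open>The Mecke equation for a single count. With Poisson weights \<open>p n\<close> and mean
  \<open>m\<close> it reads \<open>m * p n = (n + 1) * p (n + 1)\<close>; for \<open>k\<close> other
  than a positive integer both sides vanish.\<close>

lemma emeasure_count_recurrence:
  assumes B: "B \<in> sets X" "emeasure \<mu> B \<noteq> \<infinity>"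
  shows "emeasure \<mu> B * emeasure P {\<phi> \<in> space P. emeasure \<phi> B + 1 = k} =
    k * emeasure P {\<phi> \<in> space P. emeasure \<phi> B = k}"
proof -
  consider "k = \<infinity>" | "k = 0" | n where "k = of_nat (Suc n)" | "k \<notin> insert \<infinity> (range of_nat)"
    by (metis UNIV_I image_iff insert_iff not0_implies_Suc of_nat_0)
  then show ?thesis
  proof cases
    \<comment> \<open>Both probabilities are zero, and in \<open>ennreal\<close> infinity times zero
      is zero.\<close>
    case 1
    have "AE \<phi> in P. emeasure \<phi> B \<noteq> \<infinity>"
      using AE_count_finite[OF B] by eventually_elim auto
    then have "emeasure P {\<phi> \<in> space P. emeasure \<phi> B = \<infinity>} = 0"
      using sets_count_event[of B "{\<infinity>}"] B by (subst (asm) AE_iff_measurable[OF _ refl]) auto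
    then show ?thesis
      using 1 by (simp add: ennreal_add_eq_top)
  next
    case 3
    have e: "emeasure \<phi> B + 1 = k \<longleftrightarrow> emeasure \<phi> B = of_nat n" for \<phi> :: "'a measure"
      unfolding 3 by (simp add: add.commute ennreal_add_left_cancel)
    have "emeasure \<mu> B = ennreal (measure \<mu> B)"
      using B by (simp add: emeasure_eq_ennreal_measure top.not_eq_extremum)
    moreover have "k = ennreal (real (Suc n))"
      unfolding 3 by (simp only: ennreal_of_nat_eq_real_of_nat)
    moreover have "measure \<mu> B * (exp (- measure \<mu> B) * measure \<mu> B ^ n / fact n) =
        real (Suc n) * (exp (- measure \<mu> B) * measure \<mu> B ^ Suc n / fact (Suc n))"
      by (simp add: field_simps del: of_nat_Suc)
    ultimately show ?thesis
      unfolding e unfolding 3 emeasure_count_eq[OF B]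
      by (simp add: ennreal_mult'' flip: ennreal_mult' del: of_nat_Suc)
  next
    case 4
    have "emeasure \<phi> B + 1 \<noteq> k" "emeasure \<phi> B \<noteq> k" if "\<phi> \<in> space P" for \<phi>
    proof -
      have "emeasure \<phi> B + 1 \<in> insert \<infinity> (range of_nat)"
        using count_values[OF that B(1)]
        by (auto simp: add.commute simp flip: of_nat_Suc)
      then show "emeasure \<phi> B + 1 \<noteq> k" "emeasure \<phi> B \<noteq> k"
        using 4 count_values[OF that B(1)] by auto
    qed
    then have "{\<phi> \<in> space P. emeasure \<phi> B + 1 = k} = {}" "{\<phi> \<in> space P. emeasure \<phi> B = k} = {}"
      by blast+
    then show ?thesis
      by (simp only: emeasure_empty) simp
  qed simp
qed

text \<open>A point of \<open>B\<close> lies in exactly one cell \<open>e\<close> and raises only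
  the count of that cell, so the left integrand is constant on cells. The recurrence for a single
  count then trades the factor \<open>emeasure \<mu> e\<close> for \<open>k e\<close>, and on
  \<open>G\<close> the numbers \<open>k e\<close> over the cells in \<open>B\<close> add up to the
  count of \<open>B\<close>.\<close>

lemma mecke_cylinder:
  fixes k :: "'a set \<Rightarrow> ennreal"
  assumes D: "finite \<D>" "\<D> \<subseteq> sets X" "disjoint \<D>" and BD: "B = \<Union>{d \<in> \<D>. d \<subseteq> B}"
    and B: "B \<in> sets X" "emeasure \<mu> B \<noteq> \<infinity>"
  defines "G \<equiv> {\<phi> \<in> counting_measures X. \<forall>d\<in>\<D>. emeasure \<phi> d = k d}"
  shows "(\<integral>\<^sup>+x. emeasure P {\<phi> \<in> space P. add_point \<phi> x \<in> G} * indicator B x \<partial>\<mu>) =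
    (\<integral>\<^sup>+\<phi>. emeasure \<phi> B * indicator G \<phi> \<partial>P)"
proof -
  let ?\<E> = "{d \<in> \<D>. d \<subseteq> B}"
  have fE: "finite ?\<E>" using D by simp
  \<comment> \<open>Probabilities of the prescribed count without (\<open>p\<close>) and with
    (\<open>q\<close>) an added point, and the probability \<open>c e\<close> of reaching
    \<open>G\<close> from a point in \<open>e\<close>. Writing the added point as \<open>+ 1\<close>
    avoids truncated subtraction when \<open>k d = 0\<close>.\<close>
  define p where "p d = emeasure P {\<phi> \<in> space P. emeasure \<phi> d = k d}" for d
  define q where "q d = emeasure P {\<phi> \<in> space P. emeasure \<phi> d + 1 = k d}" for d
  define c where "c e = q e * (\<Prod>d\<in>\<D> - {e}. p d)" for e
  have DX: "d \<in> sets X" if "d \<in> \<D>" for d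
    using that D(2) by blast
  have G: "{\<phi> \<in> space P. \<forall>d\<in>\<D>. emeasure \<phi> d \<in> {k d}} = G"
    by (simp add: G_def space_law)
  have "emeasure P G = (\<Prod>d\<in>\<D>. p d)"
    using emeasure_joint_counts[OF D, of "\<lambda>d. {k d}"] unfolding G p_def by simp
  have Gsets: "G \<in> sets P"
    unfolding G[symmetric] using D by (intro sets.sets_Collect_finite_All sets_count_event) auto
  have disj: "d = e" if "d \<in> \<D>" "e \<in> \<D>" "x \<in> d" "x \<in> e" for d e x
    using that D(3) by (auto simp: disjoint_def)
  have c: "emeasure P {\<phi> \<in> space P. add_point \<phi> x \<in> G} = c e" if e: "e \<in> \<D>" and x: "x \<in> e" for e x
  proof -
    let ?C = "\<lambda>d. if d = e then {y. y + 1 = k d} else {k d}"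
    have "{y. y + 1 = k e} \<in> sets borel"
      using borel_measurable_vimage[of "\<lambda>y. y + 1 :: ennreal" borel "k e"]
      by (simp add: vimage_def)
    then have C: "?C d \<in> sets borel" for d by simp
    have "{\<phi> \<in> space P. add_point \<phi> x \<in> G} = {\<phi> \<in> space P. \<forall>d\<in>\<D>. emeasure \<phi> d \<in> ?C d}"
    proof (intro Collect_cong conj_cong refl)
      fix \<phi> assume phi: "\<phi> \<in> space P"
      have "emeasure (add_point \<phi> x) d = emeasure \<phi> d + (if d = e then 1 else 0)" if "d \<in> \<D>" for d
      proof -
        have "d \<in> sets \<phi>"
          using phi DX[OF that] unfolding space_law counting_measures_def by simp
        moreover have "x \<in> d \<longleftrightarrow> d = e"
          using disj[OF that e _ x] x by blast
        ultimately show ?thesis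
          by (simp add: emeasure_add_point indicator_def)
      qed
      then have "emeasure (add_point \<phi> x) d = k d \<longleftrightarrow> emeasure \<phi> d \<in> ?C d" if "d \<in> \<D>" for d
        using that by simp
      then show "add_point \<phi> x \<in> G \<longleftrightarrow> (\<forall>d\<in>\<D>. emeasure \<phi> d \<in> ?C d)"
        using phi unfolding G_def space_law by (simp add: add_points_in_counting_measures cong: ball_cong)
    qed
    also have "emeasure P \<dots> = (\<Prod>d\<in>\<D>. emeasure P {\<phi> \<in> space P. emeasure \<phi> d \<in> ?C d})"
      by (intro emeasure_joint_counts D C)
    also have "\<dots> = c e"
      unfolding c_def q_def p_def using e D(1)
      by (subst prod.remove[of _ e]) (auto intro!: arg_cong2[where f="(*)"] prod.cong)
    finally show ?thesis .
  qed
  have indB: "indicator B x = (\<Sum>e\<in>?\<E>. indicator e x :: ennreal)" for x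
  proof (cases "x \<in> B")
    case True
    then obtain e where e: "e \<in> ?\<E>" "x \<in> e" using BD by blast
    then have "(\<Sum>d\<in>?\<E>. indicator d x :: ennreal) = (\<Sum>d\<in>?\<E>. if d = e then 1 else 0)"
      using disj by (intro sum.cong refl) (auto simp: indicator_def)
    then show ?thesis
      using True e fE by simp
  next
    case False
    then have "(\<Sum>e\<in>?\<E>. indicator e x :: ennreal) = 0"
      by (intro sum.neutral) (auto simp: indicator_def)
    then show ?thesis using False by simp
  qed
  have "(\<integral>\<^sup>+x. emeasure P {\<phi> \<in> space P. add_point \<phi> x \<in> G} * indicator B x \<partial>\<mu>) =
      (\<integral>\<^sup>+x. (\<Sum>e\<in>?\<E>. c e * indicator e x) \<partial>\<mu>)"
    unfolding indB sum_distrib_left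
    by (intro nn_integral_cong sum.cong refl) (auto simp: indicator_def c)
  also have "\<dots> = (\<Sum>e\<in>?\<E>. c e * emeasure \<mu> e)"
    using DX by (subst nn_integral_sum)
      (auto simp: sets_intensity nn_integral_cmult_indicator
        intro!: borel_measurable_times_ennreal borel_measurable_indicator)
  also have "\<dots> = (\<Sum>e\<in>?\<E>. k e * emeasure P G)"
  proof (intro sum.cong refl)
    fix e assume e: "e \<in> ?\<E>"
    have "emeasure \<mu> e \<le> emeasure \<mu> B"
      using e B by (intro emeasure_mono) (auto simp: sets_intensity)
    then have fin: "emeasure \<mu> e \<noteq> \<infinity>"
      using B by (auto simp: top_unique)
    have "c e * emeasure \<mu> e = (emeasure \<mu> e * q e) * (\<Prod>d\<in>\<D> - {e}. p d)"
      by (simp add: c_def mult_ac)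
    also have "\<dots> = k e * (p e * (\<Prod>d\<in>\<D> - {e}. p d))"
      unfolding p_def q_def using e DX fin by (subst emeasure_count_recurrence) (auto simp: mult_ac)
    also have "p e * (\<Prod>d\<in>\<D> - {e}. p d) = emeasure P G"
      using e D(1) \<open>emeasure P G = _\<close> prod.remove[of \<D> e p] by simp
    finally show "c e * emeasure \<mu> e = k e * emeasure P G" .
  qed
  also have "\<dots> = (\<integral>\<^sup>+\<phi>. (\<Sum>e\<in>?\<E>. k e * indicator G \<phi>) \<partial>P)"
    using Gsets by (subst nn_integral_sum) (auto simp: nn_integral_cmult_indicator)
  also have "\<dots> = (\<integral>\<^sup>+\<phi>. emeasure \<phi> B * indicator G \<phi> \<partial>P)"
  proof (intro nn_integral_cong)
    fix \<phi> assume "\<phi> \<in> space P"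
    have "(\<Sum>e\<in>?\<E>. k e) = emeasure \<phi> B" if "\<phi> \<in> G"
      using that D BD by (subst emeasure_eq_sum_parts[of \<D> \<phi> B])
        (auto simp: G_def counting_measures_def)
    then show "(\<Sum>e\<in>?\<E>. k e * indicator G \<phi>) = emeasure \<phi> B * indicator G \<phi>"
      by (cases "\<phi> \<in> G") auto
  qed
  finally show ?thesis .
qed

text \<open>The events are the sections of one measurable set in a product space, and the
  probability of a section is measurable in the section parameter.\<close>

lemma measurable_emeasure_shift:
  assumes h: "(\<lambda>(w, \<phi>). h w \<phi>) \<in> measurable (M \<Otimes>\<^sub>M point_space X) (point_space X)"
    and F: "F \<in> sets (point_space X)"
  shows "(\<lambda>w. emeasure P {\<phi> \<in> space P. h w \<phi> \<in> F}) \<in> borel_measurable M"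
proof -
  let ?Q = "(\<lambda>(w, \<phi>). h w \<phi>) -` F \<inter> space (M \<Otimes>\<^sub>M point_space X)"
  have "?Q \<in> sets (M \<Otimes>\<^sub>M P)"
    using measurable_sets[OF h F] sets_pair_measure_cong[OF refl sets_law] by blast
  from measurable_emeasure_Pair[OF this]
  show ?thesis
    by (rule measurable_cong[THEN iffD1, rotated])
      (auto intro!: arg_cong[where f="emeasure P"] simp: space_pair_measure space_law space_point_space)
qed

lemma measurable_add_point_Pair:
  "sets M = sets X \<Longrightarrow> (\<lambda>(x, \<phi>). add_point \<phi> x) \<in> measurable (M \<Otimes>\<^sub>M point_space X) (point_space X)"
  unfolding case_prod_beta
  using measurable_add_point[OF measurable_snd[of M "point_space X"], of fst]
    measurable_fst[of M "point_space X"] measurable_cong_sets[of M X] measurable_cong_sets[of _ _ M X]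
  by (metis (no_types))

text \<open>Both sides are measures in \<open>F\<close>: an image of the restriction of
  \<open>\<mu>\<close> to \<open>B\<close> times \<open>P\<close>, with total mass at most
  \<open>emeasure \<mu> B\<close>, and \<open>P\<close> weighted by the count of \<open>B\<close>.
  They agree on the events treated in \<open>mecke_cylinder\<close>, which determine such a
  measure.\<close>

lemma mecke:
  assumes B: "B \<in> sets X" "emeasure \<mu> B \<noteq> \<infinity>" and F: "F \<in> sets (point_space X)"
  shows "(\<integral>\<^sup>+x. emeasure P {\<phi> \<in> space P. add_point \<phi> x \<in> F} * indicator B x \<partial>\<mu>) =
    (\<integral>\<^sup>+\<phi>. emeasure \<phi> B * indicator F \<phi> \<partial>P)"
proof -
  define \<mu>B where "\<mu>B = density \<mu> (indicator B)"
  have BM: "B \<in> sets \<mu>" by (simp add: sets_intensity B)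
  have sets_B: "sets \<mu>B = sets X" by (simp add: \<mu>B_def sets_intensity)
  have add: "(\<lambda>(x, \<phi>). add_point \<phi> x) \<in> measurable (\<mu>B \<Otimes>\<^sub>M point_space X) (point_space X)"
    using sets_B by (rule measurable_add_point_Pair)
  then have addP: "(\<lambda>(x, \<phi>). add_point \<phi> x) \<in> measurable (\<mu>B \<Otimes>\<^sub>M P) (point_space X)"
    using measurable_cong_sets[OF sets_pair_measure_cong[OF refl sets_law] refl] by blast
  define M where "M = distr (\<mu>B \<Otimes>\<^sub>M P) (point_space X) (\<lambda>(x, \<phi>). add_point \<phi> x)"
  define N where "N = density P (\<lambda>\<phi>. emeasure \<phi> B)"
  have M: "emeasure M F = (\<integral>\<^sup>+x. emeasure P {\<phi> \<in> space P. add_point \<phi> x \<in> F} * indicator B x \<partial>\<mu>)"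
    if F: "F \<in> sets (point_space X)" for F
  proof -
    let ?Q = "(\<lambda>(x, \<phi>). add_point \<phi> x) -` F \<inter> space (\<mu>B \<Otimes>\<^sub>M P)"
    have "emeasure M F = emeasure (\<mu>B \<Otimes>\<^sub>M P) ?Q"
      unfolding M_def by (rule emeasure_distr[OF addP F])
    also have "\<dots> = (\<integral>\<^sup>+x. emeasure P (Pair x -` ?Q) \<partial>\<mu>B)"
      by (rule emeasure_pair_measure_alt[OF measurable_sets[OF addP F]])
    also have "\<dots> = (\<integral>\<^sup>+x. emeasure P {\<phi> \<in> space P. add_point \<phi> x \<in> F} \<partial>\<mu>B)"
      by (intro nn_integral_cong arg_cong[where f="emeasure P"]) (auto simp: space_pair_measure)
    also have "\<dots> = (\<integral>\<^sup>+x. indicator B x * emeasure P {\<phi> \<in> space P. add_point \<phi> x \<in> F} \<partial>\<mu>)"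
      unfolding \<mu>B_def
      by (intro nn_integral_density borel_measurable_indicator BM
          measurable_emeasure_shift[OF measurable_add_point_Pair[OF sets_intensity] F])
    finally show ?thesis by (simp add: mult.commute)
  qed
  have N: "emeasure N F = (\<integral>\<^sup>+\<phi>. emeasure \<phi> B * indicator F \<phi> \<partial>P)"
    if "F \<in> sets (point_space X)" for F
    unfolding N_def using that by (intro emeasure_density measurable_count B) (simp add: sets_law)
  have "M = N"
  \<comment> \<open>With \<open>B\<close> as the distinguished set, only families of cells that
    build up \<open>B\<close> have to be compared.\<close>
  proof (rule point_space_measure_eqI[OF _ _ _ B(1)])
    have "emeasure M (space M) \<le> emeasure \<mu> B"
    proof -
      have "emeasure M (space M) = (\<integral>\<^sup>+x. emeasure P {\<phi> \<in> space P. add_point \<phi> x \<in> space M} * indicator B x \<partial>\<mu>)"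
        by (rule M) (simp add: M_def sets.top)
      also have "\<dots> \<le> (\<integral>\<^sup>+x. indicator B x \<partial>\<mu>)"
        by (intro nn_integral_mono) (auto simp: indicator_def emeasure_le_1)
      finally show ?thesis using BM by simp
    qed
    then show "emeasure M (space M) \<noteq> \<infinity>"
      using B(2) by (auto simp: top_unique)
    fix \<D> :: "'a set set" and k
    assume D: "finite \<D>" "\<D> \<subseteq> sets X" "disjoint \<D>" "B = \<Union>{d \<in> \<D>. d \<subseteq> B}"
    let ?G = "{\<phi> \<in> counting_measures X. \<forall>d\<in>\<D>. emeasure \<phi> d = k d}"
    have "{\<phi> \<in> space P. \<forall>d\<in>\<D>. emeasure \<phi> d \<in> {k d}} \<in> sets P"
      using D by (intro sets.sets_Collect_finite_All sets_count_event) auto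
    then have "?G \<in> sets (point_space X)"
      by (simp add: space_law sets_law)
    then show "emeasure M ?G = emeasure N ?G"
      using mecke_cylinder[OF D B, of k] by (simp add: M N)
  qed (simp_all add: M_def N_def sets_law)
  then show ?thesis
    using M[OF F] N[OF F] by simp
qed

text \<open>For a null event the right side of the Mecke equation is zero, so the nonnegative
  integrand on the left vanishes almost everywhere on each set of finite intensity. Countably many
  of these cover the space.\<close>

lemma AE_add_point_null:
  assumes F: "F \<in> sets (point_space X)" "emeasure P F = 0"
  shows "AE x in \<mu>. emeasure P {\<phi> \<in> space P. add_point \<phi> x \<in> F} = 0"
proof -
  let ?p = "\<lambda>x. emeasure P {\<phi> \<in> space P. add_point \<phi> x \<in> F}"
  obtain A :: "nat \<Rightarrow> 'a set" where A: "range A \<subseteq> sets \<mu>" "(\<Union>i. A i) = space \<mu>"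
    "\<And>i. emeasure \<mu> (A i) \<noteq> \<infinity>"
    using intensity.sigma_finite by metis
  have meas: "?p \<in> borel_measurable \<mu>"
    by (rule measurable_emeasure_shift[OF measurable_add_point_Pair[OF sets_intensity] F(1)])
  have ae: "AE x in \<mu>. x \<in> A i \<longrightarrow> ?p x = 0" for i
  proof -
    have Ai: "A i \<in> sets \<mu>" using A(1) by blast
    have "AE \<phi> in P. \<phi> \<notin> F"
      using F by (intro AE_not_in) (simp add: null_sets_def sets_law)
    then have "(\<integral>\<^sup>+\<phi>. emeasure \<phi> (A i) * indicator F \<phi> \<partial>P) = (\<integral>\<^sup>+\<phi>. 0 \<partial>P)"
      by (intro nn_integral_cong_AE) (auto elim!: eventually_mono)
    then have "(\<integral>\<^sup>+x. ?p x * indicator (A i) x \<partial>\<mu>) = 0"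
      using mecke[OF _ A(3) F(1)] Ai by (simp add: sets_intensity)
    then have "AE x in \<mu>. ?p x * indicator (A i) x = 0"
      using meas Ai by (subst (asm) nn_integral_0_iff_AE) auto
    then show ?thesis by eventually_elim (auto split: split_indicator_asm)
  qed
  have "AE x in \<mu>. \<forall>i. x \<in> A i \<longrightarrow> ?p x = 0"
    unfolding AE_all_countable using ae by blast
  then show ?thesis
    using AE_space by eventually_elim (use A(2) in blast)
qed

end

section \<open>Chernoff bounds and singularity\<close>

text \<open>For negative \<open>c\<close> put \<open>x = - c\<close>: the product of
  \<open>1 - x + x^2\<close> and \<open>1 + x + x^2 / 2\<close> is at least 1, and the second factor
  is at most \<open>exp x\<close>.\<close>

lemma exp_le_quadratic:
  fixes c :: real
  assumes "\<bar>c\<bar> \<le> 1"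
  shows "exp c \<le> 1 + c + c\<^sup>2"
proof (cases "0 \<le> c")
  case True
  then show ?thesis using exp_bound[of c] assms by simp
next
  case False
  define x where "x = - c"
  have x: "0 \<le> x" using False by (simp add: x_def)
  have q: "1 + x + x\<^sup>2 / 2 \<le> exp x"
    using exp_lower_Taylor_quadratic[OF x] .
  have "0 \<le> x\<^sup>2 / 2 + x ^ 3 / 2 + x ^ 4 / 2" using x by simp
  also have "\<dots> = (1 - x + x\<^sup>2) * (1 + x + x\<^sup>2 / 2) - 1"
    by (simp add: field_simps power2_eq_square power3_eq_cube power4_eq_xxxx)
  also have "(1 - x + x\<^sup>2) * (1 + x + x\<^sup>2 / 2) \<le> (1 - x + x\<^sup>2) * exp x"
  proof (intro mult_left_mono q)
    have "0 \<le> (1 - x)\<^sup>2 + x" using x by simp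
    then show "0 \<le> 1 - x + x\<^sup>2" by (simp add: power2_eq_square algebra_simps)
  qed
  finally have "1 \<le> (1 - x + x\<^sup>2) * exp x" by simp
  then have "exp (- x) * 1 \<le> exp (- x) * ((1 - x + x\<^sup>2) * exp x)"
    by (intro mult_left_mono) simp_all
  also have "\<dots> = 1 - x + x\<^sup>2"
    by (simp add: mult.left_commute[of "exp (- x)"] flip: exp_add)
  finally show ?thesis by (simp add: x_def)
qed

definition levels :: "('a \<Rightarrow> real) \<Rightarrow> 'a set \<Rightarrow> 'a set set" where
  "levels g C = (\<lambda>v. g -` {v} \<inter> C) ` g ` C"

definition level_value :: "('a \<Rightarrow> real) \<Rightarrow> 'a set \<Rightarrow> real" where
  "level_value g d = the_elem (g ` d)"

text \<open>For a simple function \<open>g\<close> this is \<open>\<integral>\<^bsub>C\<^esub> g d\<phi>\<close>. The level sets in \<open>levels g C\<close> are nonempty, so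
  \<^const>\<open>level_value\<close> is well defined on them.\<close>

definition count_statistic :: "('a \<Rightarrow> real) \<Rightarrow> 'a set \<Rightarrow> 'a measure \<Rightarrow> real" where
  "count_statistic g C \<phi> = (\<Sum>d\<in>levels g C. level_value g d * measure \<phi> d)"

lemma level_value_eq: "d \<in> levels g C \<Longrightarrow> x \<in> d \<Longrightarrow> level_value g d = g x"
proof -
  assume "d \<in> levels g C" "x \<in> d"
  then have "g ` d = {g x}" by (auto simp: levels_def)
  then show ?thesis by (simp add: level_value_def)
qed

lemma levels_nonempty: "d \<in> levels g C \<Longrightarrow> \<exists>x\<in>C. x \<in> d"
  by (auto simp: levels_def)

lemma levels_simple_function:
  assumes g: "simple_function X g" and C: "C \<in> sets X"
  shows "finite (levels g C)" "levels g C \<subseteq> sets X" "disjoint (levels g C)"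
proof -
  have CX: "C \<subseteq> space X" using C by (rule sets.sets_into_space)
  have "g ` C \<subseteq> g ` space X" using CX by blast
  from finite_subset[OF this simple_functionD(1)[OF g]] show "finite (levels g C)"
    unfolding levels_def by (rule finite_imageI)
  show "levels g C \<subseteq> sets X"
  proof
    fix d assume "d \<in> levels g C"
    then obtain v where "d = (g -` {v} \<inter> space X) \<inter> C"
      using CX by (auto simp: levels_def)
    then show "d \<in> sets X"
      using simple_functionD(2)[OF g, of "{v}"] C by auto
  qed
  show "disjoint (levels g C)"
    by (auto simp: levels_def disjoint_def)
qed

text \<open>Only the level set through \<open>x\<close> contributes. The free function
  \<open>h\<close> covers both Chernoff exponents, \<open>v + v^2\<close> and
  \<open>- v + v^2\<close>.\<close>

lemma sum_levels_indicator:
  assumes "finite (levels g C)"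
  shows "(\<Sum>d\<in>levels g C. h (level_value g d) * indicator d x) = (h (g x) * indicator C x :: real)"
proof (cases "x \<in> C")
  case True
  define e where "e = g -` {g x} \<inter> C"
  have e: "e \<in> levels g C" "x \<in> e" using True by (auto simp: levels_def e_def)
  have "(\<Sum>d\<in>levels g C. h (level_value g d) * indicator d x) =
      (\<Sum>d\<in>levels g C. if d = e then h (g x) else 0)"
  proof (intro sum.cong refl)
    fix d assume d: "d \<in> levels g C"
    have "x \<in> d \<longleftrightarrow> d = e" using d True by (auto simp: levels_def e_def)
    then show "h (level_value g d) * indicator d x = (if d = e then h (g x) else 0)"
      using level_value_eq[OF d] by auto
  qed
  then show ?thesis using e True assms by simp
next
  case False
  then have "x \<notin> d" if "d \<in> levels g C" for d
    using that by (auto simp: levels_def)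
  then show ?thesis using False by (simp add: indicator_def)
qed

section \<open>Exponential moments and tail bounds for weighted counts\<close>

context poisson_process
begin

text \<open>The moment generating function of a Poisson variable, read off from the exponential
  series at \<open>?m * exp c\<close>. The value 0 that \<open>measure\<close> gives to an infinite
  count concerns only a null event.\<close>

lemma nn_integral_exp_count:
  assumes B: "B \<in> sets X" "emeasure \<mu> B \<noteq> \<infinity>"
  shows "(\<integral>\<^sup>+\<phi>. ennreal (exp (c * measure \<phi> B)) \<partial>P) = ennreal (exp (measure \<mu> B * (exp c - 1)))"
proof -
  let ?m = "measure \<mu> B"
  have "(\<integral>\<^sup>+\<phi>. ennreal (exp (c * measure \<phi> B)) \<partial>P) =
      (\<Sum>k. ennreal (exp (c * real k)) * ennreal (exp (- ?m) * ?m ^ k / fact k))"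
    unfolding measure_def[of _ B]
    using nn_integral_count[OF B, of "\<lambda>y. ennreal (exp (c * enn2real y))"]
    by (simp add: measure_def)
  also have "\<dots> = (\<Sum>k. ennreal (exp (- ?m) * ((?m * exp c) ^ k /\<^sub>R fact k)))"
    by (intro suminf_cong)
      (simp add: power_mult_distrib exp_of_nat2_mult mult.commute field_simps flip: ennreal_mult')
  also have "\<dots> = ennreal (exp (- ?m) * exp (?m * exp c))"
    by (intro suminf_ennreal_eq sums_mult exp_converges) simp
  finally show ?thesis
    by (simp add: algebra_simps flip: exp_add)
qed

lemma measurable_measure_count: "B \<in> sets X \<Longrightarrow> (\<lambda>\<phi>. measure \<phi> B) \<in> borel_measurable P"
  unfolding measure_def by (intro borel_measurable_enn2real measurable_count)

text \<open>Markov's inequality for the exponential of the weighted sum. Independence factorises the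
  exponential moment, and \<open>exp_le_quadratic\<close> bounds each exponent
  \<open>exp (c d) - 1\<close>.\<close>

lemma chernoff_counts:
  assumes D: "finite \<D>" "\<D> \<subseteq> sets X" "disjoint \<D>"
    and fin: "\<And>d. d \<in> \<D> \<Longrightarrow> emeasure \<mu> d \<noteq> \<infinity>" and c: "\<And>d. d \<in> \<D> \<Longrightarrow> \<bar>c d\<bar> \<le> 1"
  shows "emeasure P {\<phi> \<in> space P. \<tau> \<le> (\<Sum>d\<in>\<D>. c d * measure \<phi> d)} \<le>
    ennreal (exp (- \<tau> + (\<Sum>d\<in>\<D>. measure \<mu> d * (c d + (c d)\<^sup>2))))"
proof -
  let ?T = "\<lambda>\<phi>. \<Sum>d\<in>\<D>. c d * measure \<phi> d"
  have "?T \<in> borel_measurable P"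
    using D by (intro borel_measurable_sum borel_measurable_times borel_measurable_const
        measurable_measure_count) auto
  then have E: "{\<phi> \<in> space P. \<tau> \<le> ?T \<phi>} \<in> sets P"
    by measurable
  have "indep_vars (\<lambda>_. borel) (\<lambda>d \<phi>. ennreal (exp (c d * enn2real (emeasure \<phi> d)))) \<D>"
    by (intro indep_vars_compose2[OF indep_counts[OF D]]) simp
  from indep_vars_nn_integral[OF D(1) this]
  have prod: "(\<integral>\<^sup>+\<phi>. (\<Prod>d\<in>\<D>. ennreal (exp (c d * measure \<phi> d))) \<partial>P) =
      (\<Prod>d\<in>\<D>. \<integral>\<^sup>+\<phi>. ennreal (exp (c d * measure \<phi> d)) \<partial>P)"
    by (simp add: measure_def)
  have "emeasure P {\<phi> \<in> space P. \<tau> \<le> ?T \<phi>} = (\<integral>\<^sup>+\<phi>. indicator {\<phi> \<in> space P. \<tau> \<le> ?T \<phi>} \<phi> \<partial>P)"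
    using E by simp
  also have "\<dots> \<le> (\<integral>\<^sup>+\<phi>. ennreal (exp (- \<tau>)) * (\<Prod>d\<in>\<D>. ennreal (exp (c d * measure \<phi> d))) \<partial>P)"
  proof (rule nn_integral_mono)
    fix \<phi>
    have "ennreal (exp (- \<tau>)) * (\<Prod>d\<in>\<D>. ennreal (exp (c d * measure \<phi> d))) = ennreal (exp (?T \<phi> - \<tau>))"
      using D(1) by (simp add: prod_ennreal exp_sum flip: ennreal_mult' exp_add exp_sum)
    moreover have "1 \<le> ennreal (exp (?T \<phi> - \<tau>))" if "\<tau> \<le> ?T \<phi>"
      using that by (simp add: ennreal_1[symmetric] del: ennreal_1)
    ultimately show "indicator {\<phi> \<in> space P. \<tau> \<le> ?T \<phi>} \<phi> \<le>
        ennreal (exp (- \<tau>)) * (\<Prod>d\<in>\<D>. ennreal (exp (c d * measure \<phi> d)))"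
      by (auto simp: indicator_def)
  qed
  also have "\<dots> = ennreal (exp (- \<tau>)) * (\<Prod>d\<in>\<D>. \<integral>\<^sup>+\<phi>. ennreal (exp (c d * measure \<phi> d)) \<partial>P)"
    unfolding prod[symmetric] using D
    by (intro nn_integral_cmult borel_measurable_prod_ennreal measurable_compose[OF _ measurable_ennreal]
        measurable_compose[OF _ borel_measurable_exp] borel_measurable_times measurable_measure_count) auto
  also have "\<dots> = ennreal (exp (- \<tau>)) * (\<Prod>d\<in>\<D>. ennreal (exp (measure \<mu> d * (exp (c d) - 1))))"
    using D fin by (intro arg_cong2[where f="(*)"] prod.cong nn_integral_exp_count) auto
  also have "\<dots> = ennreal (exp (- \<tau> + (\<Sum>d\<in>\<D>. measure \<mu> d * (exp (c d) - 1))))"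
    unfolding exp_add exp_sum[OF D(1)] by (simp add: prod_ennreal flip: ennreal_mult')
  also have "\<dots> \<le> ennreal (exp (- \<tau> + (\<Sum>d\<in>\<D>. measure \<mu> d * (c d + (c d)\<^sup>2))))"
    using exp_le_quadratic[OF c]
    by (intro ennreal_leI iffD2[OF exp_le_cancel_iff] add_left_mono sum_mono mult_left_mono)
      (auto simp: algebra_simps)
  finally show ?thesis .
qed

text \<open>The level sets of a simple function are disjoint, so the bound for weighted counts
  applies, and sums over levels become integrals over \<open>C\<close>. The lower tail is the upper
  tail for the negated weights.\<close>

lemma chernoff_count_statistic:
  assumes g: "simple_function X g" and C: "C \<in> sets X" "emeasure \<mu> C \<noteq> \<infinity>"
    and le: "\<And>x. x \<in> C \<Longrightarrow> \<bar>g x\<bar> \<le> 1"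
  shows "emeasure P {\<phi> \<in> space P. \<tau> \<le> count_statistic g C \<phi>} \<le>
      ennreal (exp (- \<tau> + (\<integral>x. (g x + (g x)\<^sup>2) * indicator C x \<partial>\<mu>)))"
    and "emeasure P {\<phi> \<in> space P. count_statistic g C \<phi> \<le> \<tau>} \<le>
      ennreal (exp (\<tau> + (\<integral>x. (- g x + (g x)\<^sup>2) * indicator C x \<partial>\<mu>)))"
proof -
  let ?\<D> = "levels g C" and ?c = "level_value g"
  note D = levels_simple_function[OF g C(1)]
  have fin: "emeasure \<mu> d \<noteq> \<infinity>" if "d \<in> ?\<D>" for d
  proof -
    have "emeasure \<mu> d \<le> emeasure \<mu> C"
      using that C by (intro emeasure_mono) (auto simp: levels_def sets_intensity)
    then show ?thesis using C by (auto simp: top_unique)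
  qed
  have c: "\<bar>?c d\<bar> \<le> 1" if "d \<in> ?\<D>" for d
    using levels_nonempty[OF that] level_value_eq[OF that] le by metis
  have int: "(\<Sum>d\<in>?\<D>. measure \<mu> d * h (?c d)) = (\<integral>x. h (g x) * indicator C x \<partial>\<mu>)"
    for h :: "real \<Rightarrow> real"
  proof -
    have "(\<integral>x. h (g x) * indicator C x \<partial>\<mu>) = (\<integral>x. (\<Sum>d\<in>?\<D>. h (?c d) * indicator d x) \<partial>\<mu>)"
      by (simp add: sum_levels_indicator[OF D(1)])
    also have "\<dots> = (\<Sum>d\<in>?\<D>. \<integral>x. h (?c d) * indicator d x \<partial>\<mu>)"
      using D fin by (intro Bochner_Integration.integral_sum integrable_mult_right integrable_real_indicator)
        (auto simp: sets_intensity less_top)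
    also have "\<dots> = (\<Sum>d\<in>?\<D>. measure \<mu> d * h (?c d))"
      using D by (intro sum.cong refl) (auto simp: sets_intensity mult.commute dest!: sets.sets_into_space[of _ \<mu>])
    finally show ?thesis ..
  qed
  show "emeasure P {\<phi> \<in> space P. \<tau> \<le> count_statistic g C \<phi>} \<le>
      ennreal (exp (- \<tau> + (\<integral>x. (g x + (g x)\<^sup>2) * indicator C x \<partial>\<mu>)))"
    using chernoff_counts[OF D fin, where c="?c" and \<tau>=\<tau>] c int[of "\<lambda>v. v + v\<^sup>2"]
    by (simp add: count_statistic_def)
  have "{\<phi> \<in> space P. count_statistic g C \<phi> \<le> \<tau>} =
      {\<phi> \<in> space P. - \<tau> \<le> (\<Sum>d\<in>?\<D>. - ?c d * measure \<phi> d)}"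
    by (simp add: count_statistic_def sum_negf)
  then show "emeasure P {\<phi> \<in> space P. count_statistic g C \<phi> \<le> \<tau>} \<le>
      ennreal (exp (\<tau> + (\<integral>x. (- g x + (g x)\<^sup>2) * indicator C x \<partial>\<mu>)))"
    using chernoff_counts[OF D fin, where c="\<lambda>d. - ?c d" and \<tau>="- \<tau>"] c int[of "\<lambda>v. - v + v\<^sup>2"]
    by simp
qed

lemma measurable_count_statistic:
  assumes "simple_function X g" "C \<in> sets X"
  shows "count_statistic g C \<in> borel_measurable P"
  unfolding count_statistic_def[abs_def] using levels_simple_function[OF assms]
  by (intro borel_measurable_sum borel_measurable_times borel_measurable_const measurable_measure_count) auto

end

section \<open>Singularity from approximately separating events\<close>

lemma mutually_singularI:
  assumes sets: "sets P = sets Q" and P: "prob_space P" and Q: "prob_space Q"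
    and ex: "\<And>\<epsilon>::real. 0 < \<epsilon> \<Longrightarrow>
      \<exists>F\<in>sets P. emeasure P F \<le> ennreal \<epsilon> \<and> emeasure Q (space Q - F) \<le> ennreal \<epsilon>"
  shows "mutually_singular P Q"
proof -
  interpret P: prob_space P by fact
  interpret Q: prob_space Q by fact
  have "\<exists>F\<in>sets P. emeasure P F \<le> ennreal ((1/2) ^ n) \<and> emeasure Q (space Q - F) \<le> ennreal ((1/2) ^ n)"
    for n :: nat
    by (rule ex) simp
  then obtain F where F: "\<And>n::nat. F n \<in> sets P" "\<And>n. emeasure P (F n) \<le> ennreal ((1/2) ^ n)"
    "\<And>n. emeasure Q (space Q - F n) \<le> ennreal ((1/2) ^ n)"
    by metis
  \<comment> \<open>The errors \<open>(1/2) ^ n\<close> are summable, as Borel-Cantelli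
    requires.\<close>
  have P0: "limsup F \<in> null_sets P"
  proof (rule borel_cantelli_limsup1)
    show "summable (\<lambda>n. measure P (F n))"
    proof (rule summable_comparison_test'[of "\<lambda>n. (1/2) ^ n"])
      show "norm (measure P (F n)) \<le> (1/2) ^ n" for n
        using F(2)[of n] by (simp add: P.emeasure_eq_measure)
    qed simp
  qed (use F(1) in \<open>auto simp: P.emeasure_eq_measure\<close>)
  \<comment> \<open>Outside \<open>limsup F\<close> a point eventually avoids all
    \<open>F m\<close>. Each tail intersection of complements has \<open>Q\<close>-measure below
    \<open>(1/2) ^ k\<close> for all large \<open>k\<close>, so it is null.\<close>
  have "space Q - limsup F \<subseteq> (\<Union>n. \<Inter>m\<in>{n..}. space Q - F m)"
    by (auto simp: limsup_INF_SUP)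
  moreover have "(\<Inter>m\<in>{n..}. space Q - F m) \<in> null_sets Q" for n
  proof -
    have meas: "(\<Inter>m\<in>{n..}. space Q - F m) \<in> sets Q"
      using F(1) sets by (intro sets.countable_INT') auto
    have le: "emeasure Q (\<Inter>m\<in>{n..}. space Q - F m) \<le> ennreal ((1/2) ^ k)" if "n \<le> k" for k
      using that F(1) sets by (intro order_trans[OF emeasure_mono F(3)[of k]]) auto
    have "emeasure Q (\<Inter>m\<in>{n..}. space Q - F m) \<le> 0"
    proof (rule LIMSEQ_le_const)
      have "(\<lambda>k. (1/2) ^ k :: real) \<longlonglongrightarrow> 0"
        by (intro LIMSEQ_power_zero) simp
      then show "(\<lambda>k. ennreal ((1/2) ^ k)) \<longlonglongrightarrow> 0"
        unfolding ennreal_0[symmetric] by (intro tendsto_ennrealI)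
    qed (use le in auto)
    then show ?thesis using meas by (simp add: null_sets_def)
  qed
  then have "(\<Union>n. \<Inter>m\<in>{n..}. space Q - F m) \<in> null_sets Q"
    by (intro null_sets_UN)
  moreover have "space Q - limsup F \<in> sets Q"
    using P0 sets by auto
  ultimately have "space Q - limsup F \<in> null_sets Q"
    using null_sets_subset by blast
  then show ?thesis
    using P0 sets unfolding mutually_singular_def by (auto simp: null_sets_def)
qed

text \<open>With \<open>q = (b - a)^2 / (a + b)\<close> the linear term equals
  \<open>- q / 8\<close> and the quadratic term is at most \<open>q / 16\<close>. Taking
  \<open>r\<close> to be \<open>a\<close> or \<open>b\<close> covers the two laws.\<close>

lemma chernoff_exponent_le:
  fixes a b r :: real
  assumes "0 \<le> a" "0 \<le> b" "r \<le> a + b"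
  defines "g \<equiv> (b - a) / (4 * (a + b))"
  shows "- (g * (b - a) / 2) + g\<^sup>2 * r \<le> - 1 / 16 * ((b - a)\<^sup>2 / (a + b))"
proof (cases "a + b = 0")
  \<comment> \<open>Division by zero yields 0, so \<open>g\<close> and both sides of the inequality
    vanish.\<close>
  case True
  then show ?thesis using assms by (simp add: g_def)
next
  case False
  then have s: "0 < a + b" using assms by linarith
  define q where "q = (b - a)\<^sup>2 / (a + b)"
  have "g\<^sup>2 * r \<le> g\<^sup>2 * (a + b)"
    using assms by (intro mult_left_mono) auto
  also have "\<dots> = q / 16"
    using s by (simp add: g_def q_def power2_eq_square divide_simps) (auto simp: algebra_simps)
  finally have "g\<^sup>2 * r \<le> q / 16" .
  moreover have "g * (b - a) = q / 4"
    using s by (simp add: g_def q_def power2_eq_square divide_simps)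
  ultimately show ?thesis unfolding q_def[symmetric] by linarith
qed

text \<open>Factor \<open>b - a\<close> into a difference and a sum of square roots and use that
  \<open>a + b\<close> is at most \<open>(sqrt a + sqrt b)^2\<close>. This passes divergence of the
  Hellinger integral on to the integral that controls the Chernoff exponent.\<close>

lemma sqrt_diff_square_le:
  fixes a b :: real
  assumes "0 \<le> a" "0 \<le> b"
  shows "(sqrt a - sqrt b)\<^sup>2 \<le> (b - a)\<^sup>2 / (a + b)"
proof (cases "a + b = 0")
  case True
  then show ?thesis using assms by (simp add: add_nonneg_eq_0_iff)
next
  case False
  then have s: "0 < a + b" using assms by linarith
  have "b - a = (sqrt b - sqrt a) * (sqrt b + sqrt a)"
    using assms by (simp add: algebra_simps)
  then have e: "(b - a)\<^sup>2 = (sqrt a - sqrt b)\<^sup>2 * (sqrt a + sqrt b)\<^sup>2"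
    by (simp add: power_mult_distrib power2_commute add.commute)
  have "a + b \<le> (sqrt a + sqrt b)\<^sup>2"
    using assms by (simp add: power2_sum)
  then have "(sqrt a - sqrt b)\<^sup>2 * (a + b) \<le> (b - a)\<^sup>2"
    unfolding e by (intro mult_left_mono) auto
  then show ?thesis using s by (simp add: pos_le_divide_eq)
qed

lemma integrable_bounded_times_indicator:
  fixes f :: "'a \<Rightarrow> real"
  assumes "f \<in> borel_measurable M" "C \<in> sets M" "emeasure M C < \<infinity>" "\<And>x. x \<in> C \<Longrightarrow> \<bar>f x\<bar> \<le> K"
  shows "integrable M (\<lambda>x. f x * indicator C x)"
  using integrableI_bounded_set_indicator[of C M f K] assms by (simp add: mult.commute)

text \<open>The event is a threshold event for the count statistic of a simple function close to
  \<open>(b - a) / (4 * (a + b))\<close>. The threshold lies midway between the means of the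
  statistic under the two laws. The limiting exponents are at most \<open>- V / 16\<close>, and the
  slack up to \<open>- V / 32\<close> absorbs the approximation error.\<close>

lemma poisson_laws_separation:
  fixes a b :: "'a \<Rightarrow> real"
  assumes P: "poisson_process X \<mu> P" and Q: "poisson_process X \<nu> Q"
    and \<rho>: "sets \<rho> = sets X"
    and a: "a \<in> borel_measurable \<rho>" "\<And>x. 0 \<le> a x" "\<mu> = density \<rho> (\<lambda>x. ennreal (a x))"
    and b: "b \<in> borel_measurable \<rho>" "\<And>x. 0 \<le> b x" "\<nu> = density \<rho> (\<lambda>x. ennreal (b x))"
    and C: "C \<in> sets \<rho>" "emeasure \<rho> C < \<infinity>" "\<And>x. x \<in> C \<Longrightarrow> a x \<le> K \<and> b x \<le> K"
  defines "V \<equiv> (\<integral>x. (b x - a x)\<^sup>2 / (a x + b x) * indicator C x \<partial>\<rho>)"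
  assumes V: "0 < V"
  shows "\<exists>F\<in>sets P. emeasure P F \<le> ennreal (exp (- V / 32)) \<and>
    emeasure Q (space Q - F) \<le> ennreal (exp (- V / 32))"
proof -
  interpret P: poisson_process X \<mu> P by fact
  interpret Q: poisson_process X \<nu> Q by fact
  note [measurable] = a(1) b(1) C(1)
  have CX: "C \<in> sets X" using C(1) \<rho> by simp
  have fin: "emeasure (density \<rho> (\<lambda>x. ennreal (r x))) C \<noteq> \<infinity>"
    if [measurable]: "r \<in> borel_measurable \<rho>" and r: "\<And>x. x \<in> C \<Longrightarrow> r x \<le> K" for r
  proof -
    have "emeasure (density \<rho> (\<lambda>x. ennreal (r x))) C = (\<integral>\<^sup>+x. ennreal (r x) * indicator C x \<partial>\<rho>)"
      by (intro emeasure_density) measurable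
    also have "\<dots> \<le> (\<integral>\<^sup>+x. ennreal K * indicator C x \<partial>\<rho>)"
      using r by (intro nn_integral_mono) (auto simp: indicator_def intro: ennreal_leI)
    also have "\<dots> < \<infinity>"
      using C by (simp add: nn_integral_cmult_indicator ennreal_mult_less_top)
    finally show ?thesis by simp
  qed
  define g\<^sub>0 where "g\<^sub>0 x = (b x - a x) / (4 * (a x + b x))" for x
  have [measurable]: "g\<^sub>0 \<in> borel_measurable \<rho>"
    unfolding g\<^sub>0_def by measurable
  then have "g\<^sub>0 \<in> borel_measurable X"
    using measurable_cong_sets[OF \<rho> refl] by blast
  then obtain g where "\<forall>i. simple_function X (g i)"
      "\<forall>x\<in>space X. (\<lambda>i. g i x) \<longlonglongrightarrow> g\<^sub>0 x"
      "\<forall>i. \<forall>x\<in>space X. \<bar>g i x\<bar> \<le> 2 * \<bar>g\<^sub>0 x\<bar>"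
    using borel_measurable_implies_sequence_metric[of g\<^sub>0 X 0] by (auto simp: dist_real_def)
  then have g: "\<And>i. simple_function X (g i)"
      "\<And>x. x \<in> space X \<Longrightarrow> (\<lambda>i. g i x) \<longlonglongrightarrow> g\<^sub>0 x"
      "\<And>i x. x \<in> space X \<Longrightarrow> \<bar>g i x\<bar> \<le> 2 * \<bar>g\<^sub>0 x\<bar>"
    by auto
  have [measurable]: "g i \<in> borel_measurable \<rho>" for i
    using borel_measurable_simple_function[OF g(1)] measurable_cong_sets[OF \<rho> refl] by blast
  have C_space: "x \<in> space X" if "x \<in> C" for x
    using that CX sets.sets_into_space by blast
  \<comment> \<open>The approximants are bounded by twice \<open>\<bar>g\<^sub>0 x\<bar>\<close>,
    hence by 1/2, which keeps them in the range where the Chernoff bound applies.\<close>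
  have g0_bound: "\<bar>g\<^sub>0 x\<bar> \<le> 1 / 4" for x
  proof (cases "a x + b x = 0")
    case False
    then have "0 < a x + b x" using a(2)[of x] b(2)[of x] by linarith
    then show ?thesis using a(2)[of x] b(2)[of x] by (simp add: g\<^sub>0_def abs_if divide_simps)
  qed (simp add: g\<^sub>0_def)
  have g_bound: "\<bar>g i x\<bar> \<le> 1 / 2" if "x \<in> C" for i x
    using g(3)[OF C_space[OF that], of i] g0_bound[of x] by linarith
  \<comment> \<open>The pointwise Chernoff exponent with the threshold included. Since
    \<open>v * a - v * (a + b) / 2\<close> and \<open>v * (a + b) / 2 - v * b\<close> both equal
    \<open>- v * (b - a) / 2\<close>, one formula serves the upper tail (\<open>r = a\<close>) and
    the lower tail (\<open>r = b\<close>).\<close>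
  define e where "e r v x = - (v x * (b x - a x) / 2) + (v x)\<^sup>2 * r x" for r v :: "'a \<Rightarrow> real" and x
  have ab: "\<bar>b x - a x\<bar> \<le> K" "\<bar>a x\<bar> \<le> K" "\<bar>b x\<bar> \<le> K" if "x \<in> C" for x
    using C(3)[OF that] a(2)[of x] b(2)[of x] by auto
  have v_bound: "\<bar>v * (b x - a x) / 2\<bar> \<le> K / 2" "\<bar>v\<^sup>2 * t\<bar> \<le> K / 2"
    if "x \<in> C" "\<bar>v\<bar> \<le> 1 / 2" "\<bar>t\<bar> \<le> K" for v t x
  proof -
    have "\<bar>v\<bar> * \<bar>b x - a x\<bar> \<le> 1 * K"
      using that ab(1)[OF that(1)] by (intro mult_mono) auto
    then show "\<bar>v * (b x - a x) / 2\<bar> \<le> K / 2" by (simp add: abs_mult)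
    have "\<bar>v\<bar> * \<bar>v\<bar> \<le> (1/2) * 1" using that by (intro mult_mono) auto
    then have "\<bar>v\<bar> * \<bar>v\<bar> * \<bar>t\<bar> \<le> 1/2 * K"
      using that by (intro mult_mono) auto
    then show "\<bar>v\<^sup>2 * t\<bar> \<le> K / 2" by (simp add: abs_mult power2_eq_square)
  qed
  have e_bound: "\<bar>e r v x\<bar> \<le> K" if "x \<in> C" "\<bar>v x\<bar> \<le> 1 / 2" "\<bar>r x\<bar> \<le> K" for r v x
    using v_bound[OF that] unfolding e_def by linarith
  have ev: "eventually (\<lambda>i. (\<integral>x. e r (g i) x * indicator C x \<partial>\<rho>) < - V / 32) sequentially"
    if [measurable]: "r \<in> borel_measurable \<rho>" and r: "\<And>x. x \<in> C \<Longrightarrow> \<bar>r x\<bar> \<le> K"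
      "\<And>x. r x \<le> a x + b x" for r
  proof -
    have [measurable]: "e r v \<in> borel_measurable \<rho>" if [measurable]: "v \<in> borel_measurable \<rho>" for v
      unfolding e_def by measurable
    have lim: "(\<lambda>i. \<integral>x. e r (g i) x * indicator C x \<partial>\<rho>) \<longlonglongrightarrow> (\<integral>x. e r g\<^sub>0 x * indicator C x \<partial>\<rho>)"
    proof (rule integral_dominated_convergence[where w="\<lambda>x. K * indicator C x"])
      show "integrable \<rho> (\<lambda>x. K * indicator C x)"
        using C by (intro integrable_bounded_times_indicator[where K="\<bar>K\<bar>"]) auto
      show "AE x in \<rho>. (\<lambda>i. e r (g i) x * indicator C x) \<longlonglongrightarrow> e r g\<^sub>0 x * indicator C x"
        unfolding e_def using g(2) sets_eq_imp_space_eq[OF \<rho>]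
        by (intro AE_I2 tendsto_intros) auto
      show "AE x in \<rho>. norm (e r (g i) x * indicator C x) \<le> K * indicator C x" for i
        using e_bound[OF _ g_bound r(1)] by (intro AE_I2) (simp add: indicator_def)
    qed measurable
    have "(\<integral>x. e r g\<^sub>0 x * indicator C x \<partial>\<rho>) \<le>
        (\<integral>x. (- 1 / 16) * ((b x - a x)\<^sup>2 / (a x + b x) * indicator C x) \<partial>\<rho>)"
    proof (rule integral_mono)
      show "integrable \<rho> (\<lambda>x. e r g\<^sub>0 x * indicator C x)"
      proof (intro integrable_bounded_times_indicator[where K=K] e_bound)
        show "\<bar>g\<^sub>0 x\<bar> \<le> 1 / 2" for x
          using g0_bound[of x] by linarith
      qed (use C r in auto)
      \<comment> \<open>A function that is not integrable has Bochner integral 0, so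
        \<open>0 < V\<close> already yields integrability.\<close>
      show "integrable \<rho> (\<lambda>x. (- 1 / 16) * ((b x - a x)\<^sup>2 / (a x + b x) * indicator C x))"
        using V not_integrable_integral_eq unfolding V_def by (intro integrable_mult_right) fastforce
      show "e r g\<^sub>0 x * indicator C x \<le> (- 1 / 16) * ((b x - a x)\<^sup>2 / (a x + b x) * indicator C x)" for x
      proof -
        have "e r g\<^sub>0 x \<le> (- 1 / 16) * ((b x - a x)\<^sup>2 / (a x + b x))"
          unfolding e_def g\<^sub>0_def by (rule chernoff_exponent_le[OF a(2) b(2) r(2)])
        then show ?thesis by (cases "x \<in> C") simp_all
      qed
    qed
    moreover have "\<dots> = (- 1 / 16) * V"
      by (simp only: integral_mult_right_zero V_def)
    ultimately have "(\<integral>x. e r g\<^sub>0 x * indicator C x \<partial>\<rho>) < - V / 32"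
      using V by linarith
    with lim show ?thesis
      by (rule order_tendstoD)
  qed
  have "eventually (\<lambda>i. (\<integral>x. e a (g i) x * indicator C x \<partial>\<rho>) < - V / 32 \<and>
      (\<integral>x. e b (g i) x * indicator C x \<partial>\<rho>) < - V / 32) sequentially"
    using a(2) b(2) ab by (intro eventually_conj ev) auto
  then obtain i where i: "(\<integral>x. e a (g i) x * indicator C x \<partial>\<rho>) < - V / 32"
    "(\<integral>x. e b (g i) x * indicator C x \<partial>\<rho>) < - V / 32"
    by (auto simp: eventually_sequentially)
  let ?g = "g i"
  define \<tau> where "\<tau> = (\<integral>x. ?g x * (a x + b x) / 2 * indicator C x \<partial>\<rho>)"
  define F where "F = {\<phi> \<in> space P. \<tau> \<le> count_statistic ?g C \<phi>}"
  have int_\<tau>: "integrable \<rho> (\<lambda>x. ?g x * (a x + b x) / 2 * indicator C x)"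
  proof (rule integrable_bounded_times_indicator[where K=K])
    fix x assume x: "x \<in> C"
    have "\<bar>?g x\<bar> * \<bar>a x + b x\<bar> \<le> 1 * (2 * K)"
      using g_bound[OF x, of i] ab[OF x] by (intro mult_mono) auto
    then show "\<bar>?g x * (a x + b x) / 2\<bar> \<le> K" by (simp add: abs_mult)
  qed (use C in auto)
  have int: "integrable \<rho> (\<lambda>x. (s * (?g x * r x) + (?g x)\<^sup>2 * r x) * indicator C x)"
    if [measurable]: "r \<in> borel_measurable \<rho>" and r: "\<And>x. x \<in> C \<Longrightarrow> \<bar>r x\<bar> \<le> K" and s: "\<bar>s\<bar> = 1" for r s
  proof (rule integrable_bounded_times_indicator[where K="2 * K"])
    fix x assume x: "x \<in> C"
    have "\<bar>?g x\<bar> * \<bar>r x\<bar> \<le> 1 * K"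
      using g_bound[OF x, of i] r[OF x] by (intro mult_mono) auto
    then have "\<bar>s * (?g x * r x)\<bar> \<le> K"
      by (simp add: abs_mult s)
    moreover have "\<bar>(?g x)\<^sup>2 * r x\<bar> \<le> K / 2"
      using v_bound(2)[OF x g_bound[OF x] r[OF x]] .
    ultimately show "\<bar>s * (?g x * r x) + (?g x)\<^sup>2 * r x\<bar> \<le> 2 * K"
      using r[OF x] by linarith
  qed (use C in auto)
  have dens: "(\<integral>x. h x * indicator C x \<partial>density \<rho> (\<lambda>x. ennreal (r x))) =
      (\<integral>x. (h x * r x) * indicator C x \<partial>\<rho>)"
    if "r \<in> borel_measurable \<rho>" "\<And>x. 0 \<le> r x" "h \<in> borel_measurable \<rho>" for h r :: "'a \<Rightarrow> real"
    using that by (subst integral_density) (auto simp: mult_ac)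
  have expP: "- \<tau> + (\<integral>x. (?g x + (?g x)\<^sup>2) * indicator C x \<partial>\<mu>) =
      (\<integral>x. e a ?g x * indicator C x \<partial>\<rho>)"
  proof -
    have "(\<integral>x. (?g x + (?g x)\<^sup>2) * indicator C x \<partial>\<mu>) =
        (\<integral>x. (?g x * a x + (?g x)\<^sup>2 * a x) * indicator C x \<partial>\<rho>)"
      unfolding a(3) using a by (subst dens) (auto simp: algebra_simps)
    then have "- \<tau> + (\<integral>x. (?g x + (?g x)\<^sup>2) * indicator C x \<partial>\<mu>) =
        (\<integral>x. (?g x * a x + (?g x)\<^sup>2 * a x) * indicator C x - ?g x * (a x + b x) / 2 * indicator C x \<partial>\<rho>)"
      unfolding \<tau>_def using int[of a 1] a(1) ab(2) int_\<tau>
      by (subst Bochner_Integration.integral_diff) simp_all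
    also have "\<dots> = (\<integral>x. e a ?g x * indicator C x \<partial>\<rho>)"
      by (intro Bochner_Integration.integral_cong refl) (auto simp: e_def indicator_def algebra_simps divide_simps)
    finally show ?thesis .
  qed
  have expQ: "\<tau> + (\<integral>x. (- ?g x + (?g x)\<^sup>2) * indicator C x \<partial>\<nu>) =
      (\<integral>x. e b ?g x * indicator C x \<partial>\<rho>)"
  proof -
    have "(\<integral>x. (- ?g x + (?g x)\<^sup>2) * indicator C x \<partial>\<nu>) =
        (\<integral>x. (- (?g x * b x) + (?g x)\<^sup>2 * b x) * indicator C x \<partial>\<rho>)"
      unfolding b(3) using b by (subst dens) (auto simp: algebra_simps)
    then have "\<tau> + (\<integral>x. (- ?g x + (?g x)\<^sup>2) * indicator C x \<partial>\<nu>) =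
        (\<integral>x. ?g x * (a x + b x) / 2 * indicator C x + (- (?g x * b x) + (?g x)\<^sup>2 * b x) * indicator C x \<partial>\<rho>)"
      unfolding \<tau>_def using int[of b "- 1"] b(1) ab(3) int_\<tau>
      by (subst Bochner_Integration.integral_add) simp_all
    also have "\<dots> = (\<integral>x. e b ?g x * indicator C x \<partial>\<rho>)"
      by (intro Bochner_Integration.integral_cong refl) (auto simp: e_def indicator_def algebra_simps divide_simps)
    finally show ?thesis .
  qed
  have le1: "\<bar>?g x\<bar> \<le> 1" if "x \<in> C" for x
    using g_bound[OF that, of i] by linarith
  have [measurable]: "count_statistic ?g C \<in> borel_measurable P"
    by (rule P.measurable_count_statistic[OF g(1) CX])
  have "F \<in> sets P"
    unfolding F_def by measurable
  moreover have "emeasure P F \<le> ennreal (exp (- V / 32))"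
  proof -
    have "emeasure \<mu> C \<noteq> \<infinity>" unfolding a(3) using C(3) by (intro fin) auto
    from P.chernoff_count_statistic(1)[OF g(1) CX this le1, where \<tau>=\<tau>]
    have "emeasure P F \<le> ennreal (exp (\<integral>x. e a ?g x * indicator C x \<partial>\<rho>))"
      unfolding F_def expP .
    also have "\<dots> \<le> ennreal (exp (- V / 32))"
      using i(1) by (intro ennreal_leI) simp
    finally show ?thesis .
  qed
  moreover have "emeasure Q (space Q - F) \<le> ennreal (exp (- V / 32))"
  proof -
    have "{\<phi> \<in> space Q. count_statistic ?g C \<phi> \<le> \<tau>} \<in> sets Q"
      using Q.measurable_count_statistic[OF g(1) CX] by measurable
    then have "emeasure Q (space Q - F) \<le> emeasure Q {\<phi> \<in> space Q. count_statistic ?g C \<phi> \<le> \<tau>}"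
      by (intro emeasure_mono) (auto simp: F_def P.space_law Q.space_law)
    moreover have "emeasure \<nu> C \<noteq> \<infinity>" unfolding b(3) using C(3) by (intro fin) auto
    from Q.chernoff_count_statistic(2)[OF g(1) CX this le1, where \<tau>=\<tau>]
    have "emeasure Q {\<phi> \<in> space Q. count_statistic ?g C \<phi> \<le> \<tau>} \<le>
        ennreal (exp (\<integral>x. e b ?g x * indicator C x \<partial>\<rho>))"
      unfolding expQ .
    moreover have "\<dots> \<le> ennreal (exp (- V / 32))"
      using i(2) by (intro ennreal_leI) simp
    ultimately show ?thesis by (meson order_trans)
  qed
  ultimately show ?thesis by blast
qed

section \<open>Densities and divergence of the Hellinger integral\<close>

lemma density_rdensity:
  assumes "sigma_finite_measure \<rho>" "sigma_finite_measure \<mu>" "absolutely_continuous \<rho> \<mu>" "sets \<mu> = sets \<rho>"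
  shows "\<mu> = density \<rho> (\<lambda>x. ennreal (rdensity \<rho> \<mu> x))"
proof -
  interpret sigma_finite_measure \<rho> by fact
  have "\<mu> = density \<rho> (RN_deriv \<rho> \<mu>)"
    using density_RN_deriv[OF assms(3,4)] by simp
  also have "\<dots> = density \<rho> (\<lambda>x. ennreal (rdensity \<rho> \<mu> x))"
  proof (rule density_cong)
    show "AE x in \<rho>. RN_deriv \<rho> \<mu> x = ennreal (rdensity \<rho> \<mu> x)"
      using RN_deriv_finite[OF assms(2-4)]
      by eventually_elim (simp add: rdensity_def less_top)
  qed (auto simp: rdensity_def)
  finally show ?thesis .
qed

lemma measurable_rdensity [measurable]: "rdensity \<rho> \<mu> \<in> borel_measurable \<rho>"
  unfolding rdensity_def by measurable

lemma rdensity_nonneg: "0 \<le> rdensity \<rho> \<mu> x"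
  by (simp add: rdensity_def)

text \<open>The sets \<open>C n\<close>, of finite measure and with both densities at most
  \<open>n\<close>, increase to the whole space. The integral of \<open>w\<close> over them
  therefore grows without bound, and the separation error \<open>exp (- V / 32)\<close> falls below
  any positive number.\<close>

lemma hellinger_infinite_imp_mutually_singular:
  assumes P: "poisson_process X \<mu> P" and Q: "poisson_process X \<nu> Q"
    and \<rho>: "sets \<rho> = sets X" "sigma_finite_measure \<rho>"
    and ac: "absolutely_continuous \<rho> \<mu>" "absolutely_continuous \<rho> \<nu>"
    and H: "hellinger_sq \<rho> \<mu> \<nu> = \<infinity>"
  shows "mutually_singular P Q"
proof -
  interpret P: poisson_process X \<mu> P by fact
  interpret Q: poisson_process X \<nu> Q by fact
  interpret \<rho>: sigma_finite_measure \<rho> by fact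
  define a where "a = rdensity \<rho> \<mu>"
  define b where "b = rdensity \<rho> \<nu>"
  have [measurable]: "a \<in> borel_measurable \<rho>" "b \<in> borel_measurable \<rho>"
    by (simp_all add: a_def b_def)
  have nonneg: "0 \<le> a x" "0 \<le> b x" for x
    by (simp_all add: a_def b_def rdensity_nonneg)
  have dens: "\<mu> = density \<rho> (\<lambda>x. ennreal (a x))" "\<nu> = density \<rho> (\<lambda>x. ennreal (b x))"
    unfolding a_def b_def
    by (rule density_rdensity[OF \<rho>(2) P.intensity.sigma_finite_measure_axioms ac(1)],
        simp add: P.sets_intensity \<rho>(1))
      (rule density_rdensity[OF \<rho>(2) Q.intensity.sigma_finite_measure_axioms ac(2)],
        simp add: Q.sets_intensity \<rho>(1))
  define w where "w x = (b x - a x)\<^sup>2 / (a x + b x)" for x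
  have [measurable]: "w \<in> borel_measurable \<rho>"
    unfolding w_def by measurable
  have w0: "0 \<le> w x" for x
    using nonneg by (simp add: w_def)
  obtain A :: "nat \<Rightarrow> 'a set" where A: "range A \<subseteq> sets \<rho>" "(\<Union>i. A i) = space \<rho>"
    "\<And>i. emeasure \<rho> (A i) \<noteq> \<infinity>" "incseq A"
    using \<rho>.sigma_finite_incseq by blast
  define C where "C n = {x \<in> A n. a x \<le> real n \<and> b x \<le> real n}" for n
  have "C n = A n \<inter> {x \<in> space \<rho>. a x \<le> real n \<and> b x \<le> real n}" for n
    using A(1) sets.sets_into_space[of "A n" \<rho>] by (auto simp: C_def)
  moreover have "{x \<in> space \<rho>. a x \<le> real n \<and> b x \<le> real n} \<in> sets \<rho>" for n
    by measurable
  ultimately have C: "C n \<in> sets \<rho>" for n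
    using A(1) by auto
  have C_fin: "emeasure \<rho> (C n) < \<infinity>" for n
  proof -
    have "emeasure \<rho> (C n) \<le> emeasure \<rho> (A n)"
      using A(1) by (intro emeasure_mono) (auto simp: C_def)
    then show ?thesis using A(3)[of n] by (auto simp: less_top top_unique)
  qed
  have "incseq C"
    using A(4) by (force simp: C_def incseq_def intro: order_trans)
  have "(\<Union>n. C n) = space \<rho>"
  proof
    show "(\<Union>n. C n) \<subseteq> space \<rho>" using C sets.sets_into_space by blast
    show "space \<rho> \<subseteq> (\<Union>n. C n)"
    proof
      fix x assume "x \<in> space \<rho>"
      then obtain n where "x \<in> A n" using A(2) by blast
      obtain m where "max (a x) (b x) \<le> real m" using real_arch_simple by blast
      moreover have "x \<in> A (max n m)" using incseqD[OF A(4), of n "max n m"] \<open>x \<in> A n\<close> by auto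
      ultimately have "x \<in> C (max n m)" by (auto simp: C_def)
      then show "x \<in> (\<Union>n. C n)" by blast
    qed
  qed
  \<comment> \<open>As a measure, \<open>?W\<close> allows continuity from below along
    \<open>C\<close>.\<close>
  let ?W = "density \<rho> (\<lambda>x. ennreal (w x))"
  have "(\<integral>\<^sup>+x. ennreal ((sqrt (a x) - sqrt (b x))\<^sup>2) \<partial>\<rho>) = \<infinity>"
    using H by (auto simp: hellinger_sq_def a_def b_def ennreal_mult_eq_top_iff)
  moreover have "(\<integral>\<^sup>+x. ennreal ((sqrt (a x) - sqrt (b x))\<^sup>2) \<partial>\<rho>) \<le> (\<integral>\<^sup>+x. ennreal (w x) \<partial>\<rho>)"
    unfolding w_def using nonneg by (intro nn_integral_mono ennreal_leI sqrt_diff_square_le)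
  moreover have "(\<integral>\<^sup>+x. ennreal (w x) \<partial>\<rho>) = emeasure ?W (space \<rho>)"
    by (subst emeasure_density) (auto intro!: nn_integral_cong)
  moreover have "(SUP n. emeasure ?W (C n)) = emeasure ?W (\<Union>n. C n)"
    using C \<open>incseq C\<close> by (intro SUP_emeasure_incseq) auto
  ultimately have SUP: "(SUP n. emeasure ?W (C n)) = \<infinity>"
    using \<open>(\<Union>n. C n) = space \<rho>\<close> by (simp add: top_unique)
  show ?thesis
  proof (rule mutually_singularI)
    show "sets P = sets Q" by (simp add: P.sets_law Q.sets_law)
    show "prob_space P" "prob_space Q" by unfold_locales
    fix \<epsilon> :: real assume "0 < \<epsilon>"
    \<comment> \<open>The 1 makes \<open>V\<close> positive, and the other term makes
      \<open>exp (- V / 32)\<close> at most \<open>\<epsilon>\<close>.\<close>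
    define L where "L = max 1 (- 32 * ln \<epsilon>)"
    have "ennreal L < (SUP n. emeasure ?W (C n))"
      unfolding SUP by simp
    then obtain n where n: "ennreal L < emeasure ?W (C n)"
      by (auto simp: less_SUP_iff)
    define V where "V = (\<integral>x. (b x - a x)\<^sup>2 / (a x + b x) * indicator (C n) x \<partial>\<rho>)"
    \<comment> \<open>On \<open>C n\<close> this bounds \<open>w\<close> by
      \<open>2 * real n\<close>, so its integral there is finite and agrees with the Bochner
      integral \<open>V\<close>.\<close>
    have w_le: "w x \<le> a x + b x" for x
    proof (cases "a x + b x = 0")
      case False
      then have "0 < a x + b x" using nonneg[of x] by linarith
      moreover have "(b x - a x)\<^sup>2 \<le> (a x + b x)\<^sup>2"
        unfolding abs_le_square_iff[symmetric] using nonneg[of x] by linarith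
      ultimately show ?thesis by (simp add: w_def pos_divide_le_eq power2_eq_square)
    qed (simp add: w_def)
    have "emeasure ?W (C n) = (\<integral>\<^sup>+x. ennreal (w x * indicator (C n) x) \<partial>\<rho>)"
      using C by (subst emeasure_density) (auto intro!: nn_integral_cong simp: indicator_def)
    also have "\<dots> = ennreal V"
      unfolding V_def w_def[symmetric]
    proof (rule nn_integral_eq_integral)
      have "\<bar>w x\<bar> \<le> 2 * real n" if "x \<in> C n" for x
        using that w_le[of x] w0[of x] by (auto simp: C_def)
      then show "integrable \<rho> (\<lambda>x. w x * indicator (C n) x)"
        using C C_fin by (intro integrable_bounded_times_indicator) auto
    qed (use w0 in auto)
    finally have "ennreal L < ennreal V" using n by simp
    then have V: "L < V" by (subst (asm) ennreal_less_iff) (auto simp: L_def)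
    then have "0 < V" by (simp add: L_def)
    have "\<exists>F\<in>sets P. emeasure P F \<le> ennreal (exp (- V / 32)) \<and>
        emeasure Q (space Q - F) \<le> ennreal (exp (- V / 32))"
      using \<open>0 < V\<close> unfolding V_def
      by (intro poisson_laws_separation[OF P Q \<rho>(1) _ _ dens(1) _ _ dens(2), where K="real n"] nonneg C C_fin)
        (auto simp: C_def)
    moreover have "exp (- V / 32) \<le> \<epsilon>"
    proof -
      have "- V / 32 \<le> ln \<epsilon>" using V by (auto simp: L_def)
      then show ?thesis using \<open>0 < \<epsilon>\<close> by (metis exp_le_cancel_iff exp_ln)
    qed
    ultimately show "\<exists>F\<in>sets P. emeasure P F \<le> ennreal \<epsilon> \<and> emeasure Q (space Q - F) \<le> ennreal \<epsilon>"
      by (meson ennreal_leI order_trans)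
  qed
qed

section \<open>Vanishing of the expansion\<close>

context poisson_process
begin

lemma measurable_add_points_Pair:
  assumes \<rho>: "sets \<rho> = sets X" and J: "J \<subseteq> I"
  shows "(\<lambda>(x, \<phi>). add_points \<phi> x J) \<in>
    measurable (PiM I (\<lambda>_. \<rho>) \<Otimes>\<^sub>M point_space X) (point_space X)"
  unfolding case_prod_beta
proof (rule measurable_add_points[OF measurable_snd])
  fix j assume "j \<in> J"
  then have "(\<lambda>x. x j) \<in> measurable (PiM I (\<lambda>_. \<rho>)) \<rho>"
    using J by (intro measurable_component_singleton) auto
  from measurable_compose[OF measurable_fst this]
  show "(\<lambda>w. fst w j) \<in> measurable (PiM I (\<lambda>_. \<rho>) \<Otimes>\<^sub>M point_space X) X"
    using measurable_cong_sets[OF refl \<rho>] by blast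
qed

lemma measurable_add_points_integrand:
  assumes \<rho>: "sets \<rho> = sets X" and S: "S \<in> sets X" and J: "J \<subseteq> I" and F: "F \<in> sets (point_space X)"
  shows "(\<lambda>x. emeasure P {\<phi> \<in> space P. add_points \<phi> x J \<in> F} * (\<Prod>i\<in>I. indicator S (x i)))
    \<in> borel_measurable (PiM I (\<lambda>_. \<rho>))"
proof (intro borel_measurable_times_ennreal borel_measurable_prod_ennreal)
  show "(\<lambda>x. emeasure P {\<phi> \<in> space P. add_points \<phi> x J \<in> F}) \<in> borel_measurable (PiM I (\<lambda>_. \<rho>))"
    by (rule measurable_emeasure_shift[OF measurable_add_points_Pair[OF \<rho> J] F])
  have "S \<in> sets \<rho>" using S \<rho> by simp
  then show "(\<lambda>x. indicator S (x j) :: ennreal) \<in> borel_measurable (PiM I (\<lambda>_. \<rho>))" if "j \<in> I" for j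
    by (intro measurable_compose[OF measurable_component_singleton[OF that] borel_measurable_indicator])
qed

lemma sets_add_points_event:
  assumes \<rho>: "sets \<rho> = sets X" and J: "J \<subseteq> I" and x: "x \<in> space (PiM I (\<lambda>_. \<rho>))"
    and F: "F \<in> sets (point_space X)"
  shows "{\<phi> \<in> space P. add_points \<phi> x J \<in> F} \<in> sets P"
proof -
  have "(\<lambda>\<phi>. add_points \<phi> x J) \<in> measurable (point_space X) (point_space X)"
    using measurable_compose[OF measurable_Pair1'[OF x] measurable_add_points_Pair[OF \<rho> J]] by simp
  then have "(\<lambda>\<phi>. add_points \<phi> x J) \<in> measurable P (point_space X)"
    using measurable_cong_sets[OF sets_law refl] by blast
  from measurable_sets[OF this F] show ?thesis
    by (simp add: vimage_def Int_def conj_commute)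
qed

lemma sets_add_point_event:
  assumes x: "x \<in> space X" and F: "F \<in> sets (point_space X)"
  shows "{\<phi> \<in> space P. add_point \<phi> x \<in> F} \<in> sets P"
proof -
  have "(\<lambda>\<phi>. add_point \<phi> x) \<in> measurable P (point_space X)"
    using x by (intro measurable_add_point) (auto simp: measurable_ident_sets sets_law)
  from measurable_sets[OF this F] show ?thesis
    by (simp add: vimage_def Int_def conj_commute)
qed

text \<open>On \<open>S\<close>, adding a point is harmless either because \<open>\<rho>\<close> is dominated by \<open>\<mu>\<close> there (off \<open>A\<close>), or
  because the points of \<open>A\<close> do not lead into \<open>F\<close>. Both properties of \<open>F\<close> pass to \<open>{\<phi>. \<phi> + \<delta>\<^bsub>y\<^esub> \<in> F}\<close>.\<close>

lemma nn_integral_add_points_null: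
  assumes \<rho>: "sets \<rho> = sets X" "sigma_finite_measure \<rho>" and S: "S \<in> sets X"
    and dom: "\<And>R. (AE x in \<mu>. R x) \<Longrightarrow> (AE x in \<rho>. x \<in> S - A \<longrightarrow> R x)"
    and I: "finite I" "J \<subseteq> I"
    and F: "F \<in> sets (point_space X)" "emeasure P F = 0"
      "\<And>x \<phi>. x \<in> A \<Longrightarrow> \<phi> \<in> space P \<Longrightarrow> add_point \<phi> x \<in> F \<Longrightarrow> \<phi> \<in> F"
  shows "(\<integral>\<^sup>+x. emeasure P {\<phi> \<in> space P. add_points \<phi> x J \<in> F} * (\<Prod>i\<in>I. indicator S (x i))
    \<partial>PiM I (\<lambda>_. \<rho>)) = 0"
  using I F
\<comment> \<open>The event has to vary: if \<open>i\<close> \<in> \<open>J\<close>, the induction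
  hypothesis is applied to the preimage \<open>G\<close> of \<open>F\<close> under adding the point
  \<open>y\<close>.\<close>
proof (induction I arbitrary: J F rule: finite_induct)
  case empty
  then have "{\<phi> \<in> space P. add_points \<phi> x {} \<in> F} = F" for x
    using sets.sets_into_space[of F "point_space X"] sets_eq_imp_space_eq[OF sets_law]
    by (auto simp: add_points_empty)
  with empty show ?case by simp
next
  case (insert i I)
  interpret product_sigma_finite "\<lambda>_. \<rho>"
    by (simp add: product_sigma_finite_def \<rho>)
  let ?h = "\<lambda>x. emeasure P {\<phi> \<in> space P. add_points \<phi> x J \<in> F} * (\<Prod>i\<in>insert i I. indicator S (x i))"
  have meas: "?h \<in> borel_measurable (PiM (insert i I) (\<lambda>_. \<rho>))"
    by (rule measurable_add_points_integrand[OF \<rho>(1) S insert.prems(1,2)])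
  let ?null = "\<lambda>y. emeasure P {\<phi> \<in> space P. add_point \<phi> y \<in> F} = 0"
  have "AE y in \<rho>. y \<in> S - A \<longrightarrow> ?null y"
    by (intro dom AE_add_point_null insert.prems)
  then have "AE y in \<rho>. (\<integral>\<^sup>+x. ?h (x(i := y)) \<partial>PiM I (\<lambda>_. \<rho>)) = 0"
    using AE_space
  proof eventually_elim
    case (elim y)
    then have y: "y \<in> space X"
      using sets_eq_imp_space_eq[OF \<rho>(1)] by simp
    show ?case
    proof (cases "y \<in> S")
      case True
      have null: "?null y"
      proof (cases "y \<in> A")
        case A: True
        then have "{\<phi> \<in> space P. add_point \<phi> y \<in> F} \<subseteq> F"
          using insert.prems(4) by auto
        then show ?thesis
          using insert.prems(2,3) emeasure_mono[of _ F P] by (simp add: sets_law)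
      qed (use elim(1) True in auto)
      have prod: "(\<Prod>j\<in>insert i I. indicator S ((x(i := y)) j)) = (\<Prod>j\<in>I. indicator S (x j) :: ennreal)" for x
      proof -
        have "(\<Prod>j\<in>I. indicator S ((x(i := y)) j)) = (\<Prod>j\<in>I. indicator S (x j) :: ennreal)"
          using insert.hyps by (intro prod.cong) auto
        then show ?thesis using insert.hyps True by simp
      qed
      show ?thesis
      proof (cases "i \<in> J")
        case False
        then have "J \<subseteq> I" using insert.prems(1) by auto
        have "(\<integral>\<^sup>+x. emeasure P {\<phi> \<in> space P. add_points \<phi> x J \<in> F} * (\<Prod>i\<in>I. indicator S (x i))
            \<partial>PiM I (\<lambda>_. \<rho>)) = 0"
          by (rule insert.IH) (fact \<open>J \<subseteq> I\<close> insert.prems)+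
        then show ?thesis
          by (simp only: prod add_points_upd_notin[OF False])
      next
        case iJ: True
        define J' where "J' = J - {i}"
        have J': "J = insert i J'" "i \<notin> J'" "J' \<subseteq> I" "finite J'"
          using iJ insert.prems(1) insert.hyps(1) by (auto simp: J'_def intro: finite_subset)
        define G where "G = {\<phi> \<in> space P. add_point \<phi> y \<in> F}"
        have eq: "{\<phi> \<in> space P. add_points \<phi> (x(i := y)) J \<in> F} = {\<phi> \<in> space P. add_points \<phi> x J' \<in> G}" for x
          using J' by (auto simp: add_points_insert G_def space_law add_points_in_counting_measures)
        have "(\<integral>\<^sup>+x. emeasure P {\<phi> \<in> space P. add_points \<phi> x J' \<in> G} * (\<Prod>i\<in>I. indicator S (x i))
            \<partial>PiM I (\<lambda>_. \<rho>)) = 0"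
        proof (rule insert.IH[OF J'(3)])
          show "G \<in> sets (point_space X)"
            using sets_add_point_event[OF y insert.prems(2)] by (simp add: G_def sets_law)
          show "emeasure P G = 0" using null by (simp add: G_def)
          fix x \<phi> assume "x \<in> A" "\<phi> \<in> space P" "add_point \<phi> x \<in> G"
          \<comment> \<open>Since points may be added in either order, \<open>G\<close> inherits
            from \<open>F\<close> that points of \<open>A\<close> cannot lead into it.\<close>
          then have "add_point (add_point \<phi> y) x \<in> F" "add_point \<phi> y \<in> space P"
            by (auto simp: G_def add_point_commute[of \<phi> y x] space_law add_points_in_counting_measures)
          then show "\<phi> \<in> G"
            using insert.prems(4) \<open>x \<in> A\<close> \<open>\<phi> \<in> space P\<close> by (auto simp: G_def)
        qed
        then show ?thesis by (simp only: eq prod)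
      qed
    next
      case False
      then have "?h (x(i := y)) = 0" for x
        using insert.hyps by simp
      then show ?thesis by (simp only: nn_integral_const mult_zero_left)
    qed
  qed
  then show ?case
    by (subst product_nn_integral_insert_rev[OF insert.hyps meas])
      (simp add: nn_integral_cong_AE[where v="\<lambda>_. 0"])
qed

text \<open>A nonnegative function with zero integral vanishes almost everywhere, and for tuples in
  \<open>S\<close> the product of indicators is 1, so the probability factor itself must
  vanish.\<close>

lemma AE_add_points_notin:
  assumes \<rho>: "sets \<rho> = sets X" "sigma_finite_measure \<rho>" and S: "S \<in> sets X"
    and dom: "\<And>R. (AE x in \<mu>. R x) \<Longrightarrow> (AE x in \<rho>. x \<in> S - A \<longrightarrow> R x)"
    and I: "finite I" "J \<subseteq> I"
    and F: "F \<in> sets (point_space X)" "emeasure P F = 0"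
      "\<And>x \<phi>. x \<in> A \<Longrightarrow> \<phi> \<in> space P \<Longrightarrow> add_point \<phi> x \<in> F \<Longrightarrow> \<phi> \<in> F"
  shows "AE x in PiM I (\<lambda>_. \<rho>). (\<forall>i\<in>I. x i \<in> S) \<longrightarrow> (AE \<phi> in P. add_points \<phi> x J \<notin> F)"
proof -
  let ?h = "\<lambda>x. emeasure P {\<phi> \<in> space P. add_points \<phi> x J \<in> F} * (\<Prod>i\<in>I. indicator S (x i))"
  have "?h \<in> borel_measurable (PiM I (\<lambda>_. \<rho>))"
    by (rule measurable_add_points_integrand[OF \<rho>(1) S I(2) F(1)])
  moreover have "(\<integral>\<^sup>+x. ?h x \<partial>PiM I (\<lambda>_. \<rho>)) = 0"
    by (rule nn_integral_add_points_null[where A=A]) fact+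
  ultimately have "AE x in PiM I (\<lambda>_. \<rho>). ?h x = 0"
    by (simp only: nn_integral_0_iff_AE)
  then show ?thesis
    using AE_space
  proof eventually_elim
    case (elim x)
    show ?case
    proof
      assume "\<forall>i\<in>I. x i \<in> S"
      then have "emeasure P {\<phi> \<in> space P. add_points \<phi> x J \<in> F} = 0"
        using elim(1) I(1) by simp
      then have "AE \<phi> in P. \<phi> \<notin> {\<phi> \<in> space P. add_points \<phi> x J \<in> F}"
        using sets_add_points_event[OF \<rho>(1) I(2) elim(2) F(1)] by (intro AE_not_in) (simp add: null_sets_def)
      then show "AE \<phi> in P. add_points \<phi> x J \<notin> F"
        using AE_space by eventually_elim simp
    qed
  qed
qed

end

section \<open>Terms of the expansion for a null event\<close>

lemma AE_density_rdensity:
  assumes \<mu>: "\<mu> = density \<rho> (\<lambda>x. ennreal (rdensity \<rho> \<mu> x))" and R: "AE x in \<mu>. R x"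
  shows "AE x in \<rho>. rdensity \<rho> \<mu> x \<noteq> 0 \<longrightarrow> R x"
proof -
  have "AE x in density \<rho> (\<lambda>x. ennreal (rdensity \<rho> \<mu> x)). R x"
    \<comment> \<open>Because \<open>\<mu>\<close> also occurs inside its own density, only the
      measure governing the almost-everywhere statement is replaced.\<close>
    by (rule subst[where P="\<lambda>M. almost_everywhere M R", OF \<mu> R])
  then have "AE x in \<rho>. 0 < ennreal (rdensity \<rho> \<mu> x) \<longrightarrow> R x"
    by (subst (asm) AE_density) auto
  then show ?thesis
    by eventually_elim (auto simp: ennreal_less_zero_iff less_le rdensity_nonneg)
qed

text \<open>For almost every tuple, either some coordinate lies outside \<open>S\<close> and the
  product of density differences is zero, or all coordinates lie in \<open>S\<close> and every
  shifted indicator in the difference operator vanishes almost surely.\<close>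

lemma diff_power_integral_null_event:
  fixes \<Omega> :: "'w measure"
  assumes P: "poisson_process X \<mu> P"
    and \<rho>: "sets \<rho> = sets X" "sigma_finite_measure \<rho>" and ac: "absolutely_continuous \<rho> \<mu>"
    and \<Phi>: "\<Phi> \<in> measurable \<Omega> (point_space X)" "distr \<Omega> (point_space X) \<Phi> = P"
    and F: "F \<in> sets (point_space X)" "emeasure P F = 0"
      "\<And>x \<phi>. rdensity \<rho> \<mu> x = 0 \<Longrightarrow> rdensity \<rho> \<nu> x \<noteq> 0 \<Longrightarrow> x \<in> space X \<Longrightarrow>
        \<phi> \<in> space P \<Longrightarrow> add_point \<phi> x \<in> F \<Longrightarrow> \<phi> \<in> F"
  shows "diff_power_integral \<rho> \<nu> \<mu> n (\<lambda>x. \<integral>\<omega>. difference_op n x (indicator F) (\<Phi> \<omega>) \<partial>\<Omega>) = 0"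
proof -
  interpret P: poisson_process X \<mu> P by fact
  let ?I = "{1..n}" and ?a = "rdensity \<rho> \<mu>" and ?b = "rdensity \<rho> \<nu>"
  \<comment> \<open>\<open>S\<close> carries the signed density. At points of \<open>S\<close>
    outside \<open>A\<close> the density of \<open>\<mu>\<close> is nonzero, so statements valid
    \<open>\<mu>\<close>-almost everywhere hold \<open>\<rho>\<close>-almost everywhere
    there.\<close>
  define S where "S = {x \<in> space \<rho>. ?a x \<noteq> ?b x}"
  define A where "A = {x \<in> space \<rho>. ?a x = 0 \<and> ?b x \<noteq> 0}"
  have "S \<in> sets \<rho>"
    unfolding S_def by measurable
  then have S: "S \<in> sets X" using \<rho> by simp
  have dom: "AE x in \<rho>. x \<in> S - A \<longrightarrow> R x" if "AE x in \<mu>. R x" for R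
  proof -
    have "\<mu> = density \<rho> (\<lambda>x. ennreal (?a x))"
      using \<rho> P.sets_intensity by (intro density_rdensity[OF \<rho>(2) P.intensity.sigma_finite_measure_axioms ac]) simp
    from AE_density_rdensity[OF this that] show ?thesis
      by eventually_elim (auto simp: S_def A_def)
  qed
  have F3: "\<phi> \<in> F" if "x \<in> A" "\<phi> \<in> space P" "add_point \<phi> x \<in> F" for x \<phi>
    using F(3)[of x \<phi>] that sets_eq_imp_space_eq[OF \<rho>(1)] by (simp add: A_def)
  have "AE x in PiM ?I (\<lambda>_. \<rho>). \<forall>J\<in>Pow ?I. (\<forall>i\<in>?I. x i \<in> S) \<longrightarrow> (AE \<phi> in P. add_points \<phi> x J \<notin> F)"
  proof (rule AE_finite_allI)
    fix J assume "J \<in> Pow ?I"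
    then have J: "J \<subseteq> ?I" by blast
    show "AE x in PiM ?I (\<lambda>_. \<rho>). (\<forall>i\<in>?I. x i \<in> S) \<longrightarrow> (AE \<phi> in P. add_points \<phi> x J \<notin> F)"
      by (intro P.AE_add_points_notin[where A=A]) (fact \<rho> S dom J F(1,2) F3 finite_atLeastAtMost)+
  qed simp
  then have "AE x in PiM ?I (\<lambda>_. \<rho>). (\<integral>\<omega>. difference_op n x (indicator F) (\<Phi> \<omega>) \<partial>\<Omega>) *
      (\<Prod>j\<in>?I. ?b (x j) - ?a (x j)) = 0"
    using AE_space
  proof eventually_elim
    case (elim x)
    show ?case
    proof (cases "\<forall>i\<in>?I. x i \<in> S")
      case True
      then have "AE \<phi> in P. \<forall>J\<in>Pow ?I. add_points \<phi> x J \<notin> F"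
        using elim by (intro AE_finite_allI) auto
      then have "AE \<omega> in \<Omega>. \<forall>J\<in>Pow ?I. add_points (\<Phi> \<omega>) x J \<notin> F"
        unfolding \<Phi>(2)[symmetric] by (rule AE_distrD[OF \<Phi>(1)])
      then have "AE \<omega> in \<Omega>. difference_op n x (indicator F) (\<Phi> \<omega>) = 0"
        by eventually_elim (simp add: difference_op_def)
      then show ?thesis
        by (simp add: integral_eq_zero_AE)
    next
      case False
      then obtain i where i: "i \<in> ?I" "x i \<notin> S" by blast
      moreover have "x i \<in> space \<rho>"
        using elim(2) i(1) by (auto simp: space_PiM PiE_iff)
      ultimately have "?b (x i) - ?a (x i) = 0"
        by (auto simp: S_def)
      then have "(\<Prod>j\<in>?I. ?b (x j) - ?a (x j)) = 0"
        using i(1) by (intro prod_zero) auto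
      then show ?thesis by simp
    qed
  qed
  then show ?thesis
    unfolding diff_power_integral_def by (rule integral_eq_zero_AE)
qed

text \<open>An added point of \<open>A\<close> does not change whether the count of \<open>A\<close>
  is infinite and never leaves that count zero, so both candidate events are stable. If
  \<open>emeasure \<nu> A\<close> is finite, the count is zero with positive
  \<open>Q\<close>-probability, and intersecting with the \<open>Q\<close>-full set \<open>G\<close>
  keeps that mass.\<close>

lemma mutually_singular_stable_event:
  assumes P: "poisson_process X \<mu> P" and Q: "poisson_process X \<nu> Q"
    and A: "A \<in> sets X" "emeasure \<mu> A = 0" and sing: "mutually_singular P Q"
  obtains F where "F \<in> sets (point_space X)" "emeasure P F = 0" "emeasure Q F \<noteq> 0"
    "\<forall>x\<in>A. \<forall>\<phi>\<in>space P. add_point \<phi> x \<in> F \<longrightarrow> \<phi> \<in> F"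
proof -
  interpret P: poisson_process X \<mu> P by fact
  interpret Q: poisson_process X \<nu> Q by fact
  have add: "emeasure (add_point \<phi> x) A = emeasure \<phi> A + 1" if "x \<in> A" "\<phi> \<in> space P" for x \<phi>
    using that A(1) by (simp add: emeasure_add_point P.space_law counting_measures_def)
  show thesis
  proof (cases "emeasure \<nu> A = \<infinity>")
    case True
    let ?F = "{\<phi> \<in> space P. emeasure \<phi> A \<in> {\<infinity>}}"
    have F: "?F \<in> sets P" using A(1) by (rule P.sets_count_event) simp
    show thesis
    proof (rule that)
      show "?F \<in> sets (point_space X)" using F by (simp add: P.sets_law)
      have "AE \<phi> in P. emeasure \<phi> A \<noteq> \<infinity>"
        using P.AE_count_finite[OF A(1)] A(2) by (auto elim!: eventually_mono)
      then show "emeasure P ?F = 0"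
        using AE_iff_measurable[OF F, of "\<lambda>\<phi>. emeasure \<phi> A \<noteq> \<infinity>"] by simp
      have "AE \<phi> in Q. emeasure \<phi> A = \<infinity>"
        using A(1) True by (rule Q.AE_count_infinite)
      then have "AE \<phi> in Q. \<phi> \<in> ?F"
        using AE_space by eventually_elim (simp add: P.space_law Q.space_law)
      then have "emeasure Q ?F = 1"
        using F by (intro Q.emeasure_eq_1_AE) (auto simp: P.sets_law Q.sets_law)
      then show "emeasure Q ?F \<noteq> 0" by simp
    qed (use add in \<open>auto simp: ennreal_add_eq_top\<close>)
  next
    case False
    from sing obtain G where G: "G \<in> sets P" "emeasure P G = 0" "emeasure Q (space Q - G) = 0"
      unfolding mutually_singular_def by blast
    have GQ: "G \<in> sets Q" using G by (simp add: P.sets_law Q.sets_law)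
    let ?E = "{\<phi> \<in> space P. emeasure \<phi> A \<in> {0}}"
    have E: "?E \<in> sets P" using A(1) by (rule P.sets_count_event) simp
    then have EQ: "?E \<in> sets Q" by (simp add: P.sets_law Q.sets_law)
    show thesis
    proof (rule that)
      show "G \<inter> ?E \<in> sets (point_space X)" using G E by (simp add: P.sets_law)
      show "emeasure P (G \<inter> ?E) = 0"
        using G emeasure_mono[of "G \<inter> ?E" G P] by simp
      have "?E = {\<phi> \<in> space Q. emeasure \<phi> A = of_nat 0}"
        by (auto simp: P.space_law Q.space_law)
      then have "emeasure Q ?E \<noteq> 0"
        using Q.emeasure_count_eq[OF A(1) False, of 0] by (simp add: ennreal_eq_0_iff not_le)
      moreover have "emeasure Q ?E \<le> emeasure Q (G \<inter> ?E) + emeasure Q (space Q - G)"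
      proof -
        have "emeasure Q ?E \<le> emeasure Q ((G \<inter> ?E) \<union> (space Q - G))"
          by (intro emeasure_mono sets.Un sets.Int sets.compl_sets GQ EQ) (auto simp: P.space_law Q.space_law)
        also have "\<dots> \<le> emeasure Q (G \<inter> ?E) + emeasure Q (space Q - G)"
          using GQ EQ by (intro emeasure_subadditive) auto
        finally show ?thesis .
      qed
      ultimately show "emeasure Q (G \<inter> ?E) \<noteq> 0"
        using G(3) by auto
    qed (use add in auto)
  qed
qed

text \<open>Stating the expansion with \<open>sums\<close> makes convergence of the series part of
  the hypothesis, next to integrability of each term; \<open>Suc k\<close> lets the summation start
  at order one.\<close>

theorem theorem5p1:
  fixes X \<mu> \<nu> \<rho> :: "'a measure"
    and \<Omega> P\<^sub>\<mu> P\<^sub>\<nu> :: "'w measure"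
    and \<Phi> :: "'w \<Rightarrow> 'a measure"
    and \<Pi>\<^sub>\<mu> \<Pi>\<^sub>\<nu> :: "'a measure measure"
  assumes "sets \<mu> = sets X" "sigma_finite_measure \<mu>"
    and "sets \<nu> = sets X" "sigma_finite_measure \<nu>"
    and "sets \<rho> = sets X" "sigma_finite_measure \<rho>"
    and "absolutely_continuous \<rho> \<mu>" "absolutely_continuous \<rho> \<nu>"
    and "poisson_process_law X \<mu> \<Pi>\<^sub>\<mu>" "poisson_process_law X \<nu> \<Pi>\<^sub>\<nu>"
    and "\<Phi> \<in> measurable \<Omega> (point_space X)"
    and "prob_space P\<^sub>\<mu>" "sets P\<^sub>\<mu> = sets \<Omega>" "distr P\<^sub>\<mu> (point_space X) \<Phi> = \<Pi>\<^sub>\<mu>"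
    and "prob_space P\<^sub>\<nu>" "sets P\<^sub>\<nu> = sets \<Omega>" "distr P\<^sub>\<nu> (point_space X) \<Phi> = \<Pi>\<^sub>\<nu>"
    and "\<And>f :: 'a measure \<Rightarrow> real.
      f \<in> borel_measurable (point_space X) \<Longrightarrow> bounded (f ` space (point_space X)) \<Longrightarrow>
      (\<forall>n\<ge>1. diff_power_integrable \<rho> \<nu> \<mu> n (\<lambda>x. \<integral>\<omega>. difference_op n x f (\<Phi> \<omega>) \<partial>P\<^sub>\<mu>)) \<and>
      (\<lambda>k. 1 / fact (Suc k) *
         diff_power_integral \<rho> \<nu> \<mu> (Suc k) (\<lambda>x. \<integral>\<omega>. difference_op (Suc k) x f (\<Phi> \<omega>) \<partial>P\<^sub>\<mu>))
        sums ((\<integral>\<omega>. f (\<Phi> \<omega>) \<partial>P\<^sub>\<nu>) - (\<integral>\<omega>. f (\<Phi> \<omega>) \<partial>P\<^sub>\<mu>))"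
  shows "\<not> mutually_singular \<Pi>\<^sub>\<mu> \<Pi>\<^sub>\<nu> \<and> hellinger_sq \<rho> \<mu> \<nu> < \<infinity>"
proof -
  have P: "poisson_process X \<mu> \<Pi>\<^sub>\<mu>" and Q: "poisson_process X \<nu> \<Pi>\<^sub>\<nu>"
    using assms(1-4,9,10)
    by (auto simp: poisson_process_def poisson_process_axioms_def poisson_process_law_def)
  interpret P: poisson_process X \<mu> \<Pi>\<^sub>\<mu> by fact
  interpret Q: poisson_process X \<nu> \<Pi>\<^sub>\<nu> by fact
  have \<Phi>: "\<Phi> \<in> measurable P\<^sub>\<mu> (point_space X)" "\<Phi> \<in> measurable P\<^sub>\<nu> (point_space X)"
    using assms(11) measurable_cong_sets[OF assms(13) refl] measurable_cong_sets[OF assms(16) refl]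
    by blast+
  have nonsingular: "\<not> mutually_singular \<Pi>\<^sub>\<mu> \<Pi>\<^sub>\<nu>"
  proof
    assume sing: "mutually_singular \<Pi>\<^sub>\<mu> \<Pi>\<^sub>\<nu>"
    define A where "A = {x \<in> space \<rho>. rdensity \<rho> \<mu> x = 0 \<and> rdensity \<rho> \<nu> x \<noteq> 0}"
    have A: "A \<in> sets \<rho>"
      unfolding A_def by measurable
    have "\<mu> = density \<rho> (\<lambda>x. ennreal (rdensity \<rho> \<mu> x))"
      using assms(1,5) by (intro density_rdensity[OF assms(6,2,7)]) simp
    then have "emeasure \<mu> A = emeasure (density \<rho> (\<lambda>x. ennreal (rdensity \<rho> \<mu> x))) A"
      by simp
    also have "\<dots> = (\<integral>\<^sup>+x. ennreal (rdensity \<rho> \<mu> x) * indicator A x \<partial>\<rho>)"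
      using A by (intro emeasure_density) auto
    also have "\<dots> = (\<integral>\<^sup>+x. 0 \<partial>\<rho>)"
      by (intro nn_integral_cong) (auto simp: A_def indicator_def)
    finally have "emeasure \<mu> A = 0" by simp
    have AX: "A \<in> sets X" using A assms(5) by simp
    obtain F where F: "F \<in> sets (point_space X)" "emeasure \<Pi>\<^sub>\<mu> F = 0"
      "emeasure \<Pi>\<^sub>\<nu> F \<noteq> 0"
      and stable: "\<forall>x\<in>A. \<forall>\<phi>\<in>space \<Pi>\<^sub>\<mu>. add_point \<phi> x \<in> F \<longrightarrow> \<phi> \<in> F"
      by (rule mutually_singular_stable_event[OF P Q AX \<open>emeasure \<mu> A = 0\<close> sing])
    let ?f = "indicator F :: 'a measure \<Rightarrow> real"
    have meas: "?f \<in> borel_measurable (point_space X)"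
      using F(1) by simp
    have bdd: "bounded (?f ` space (point_space X))"
      by (rule boundedI[of _ 1]) (auto simp: indicator_def)
    have zero: "diff_power_integral \<rho> \<nu> \<mu> n (\<lambda>x. \<integral>\<omega>. difference_op n x ?f (\<Phi> \<omega>) \<partial>P\<^sub>\<mu>) = 0" for n
    proof (rule diff_power_integral_null_event[OF P assms(5,6,7) \<Phi>(1) assms(14) F(1,2)])
      fix x \<phi>
      assume "rdensity \<rho> \<mu> x = 0" "rdensity \<rho> \<nu> x \<noteq> 0" "x \<in> space X"
        and \<phi>: "\<phi> \<in> space \<Pi>\<^sub>\<mu>" "add_point \<phi> x \<in> F"
      then have "x \<in> A"
        using sets_eq_imp_space_eq[OF assms(5)] by (simp add: A_def)
      then show "\<phi> \<in> F"
        using stable \<phi> by blast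
    qed
    \<comment> \<open>All terms of the expansion of \<open>?f\<close> vanish, so both laws give
      \<open>F\<close> the same probability, although only one of the two is zero.\<close>
    have "(\<lambda>k. 0) sums ((\<integral>\<omega>. ?f (\<Phi> \<omega>) \<partial>P\<^sub>\<nu>) - (\<integral>\<omega>. ?f (\<Phi> \<omega>) \<partial>P\<^sub>\<mu>))"
      using assms(18)[OF meas bdd] by (simp add: zero)
    then have "(\<integral>\<omega>. ?f (\<Phi> \<omega>) \<partial>P\<^sub>\<nu>) = (\<integral>\<omega>. ?f (\<Phi> \<omega>) \<partial>P\<^sub>\<mu>)"
      using sums_unique2[OF sums_zero] by fastforce
    moreover have "(\<integral>\<omega>. ?f (\<Phi> \<omega>) \<partial>P\<^sub>\<nu>) = measure \<Pi>\<^sub>\<nu> F"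
      using integral_distr[OF \<Phi>(2) meas] F(1) assms(17) sets.sets_into_space[OF F(1)]
      by (simp add: Q.sets_law Int_absorb2 space_point_space Q.space_law)
    moreover have "(\<integral>\<omega>. ?f (\<Phi> \<omega>) \<partial>P\<^sub>\<mu>) = measure \<Pi>\<^sub>\<mu> F"
      using integral_distr[OF \<Phi>(1) meas] F(1) assms(14) sets.sets_into_space[OF F(1)]
      by (simp add: P.sets_law Int_absorb2 space_point_space P.space_law)
    ultimately show False
      using F(2,3) by (simp add: Q.emeasure_eq_measure P.emeasure_eq_measure)
  qed
  moreover have "hellinger_sq \<rho> \<mu> \<nu> < \<infinity>"
    using nonsingular hellinger_infinite_imp_mutually_singular[OF P Q assms(5-8)]
    by (auto simp: top.not_eq_extremum[symmetric])
  ultimately show ?thesis ..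
qed

end
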